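(* Let $m\in\mathbb{N}$ and let $p$ be a minimal idempotent in $(\beta\mathbb{N},+)$. Then for every $A\in\bigotimes_{i=1}^m p$ and every $T\in\mathcal{P}_f(\mathbb{P})$ there exist functions $\alpha:\mathcal{P}_f(\mathbb{N}^{\mathbb{N}})\to\mathbb{N}$ and $H:\mathcal{P}_f(\mathbb{N}^{\mathbb{N}})\to\mathcal{P}_f(\mathbb{N})$ such that (1) if $G,K\in\mathcal{P}_f(\mathbb{N}^{\mathbb{N}})$ and $G\subsetneq K$, then $H(G)<H(K)$; and (2) if $n\in\mathbb{N}$ with $n\ge m$, and $G_1\subsetneq G_2\subsetneq\cdots\subsetneq G_n$ in $\mathcal{P}_f(\mathbb{N}^{\mathbb{N}})$, then for all $\beta_1<\beta_2<\cdots<\beta_m$ in $\mathcal{P}_f(\mathbb{N})$ with $\max\beta_m\le n$, all $f_i\in G_i$ ($i\in\{1,\ldots,n\}$), and all $P_1,\ldots,P_m\in T$, $$\left(\sum_{i\in\beta_1}\alpha(G_i)+P_1\Bigl(\sum_{i\in\beta_1}\sum_{t\in H(G_i)}f_i(t)\Bigr),\ldots,\sum_{i\in\beta_m}\alpha(G_i)+P_m\Bigl(\sum_{i\in\beta_m}\sum_{t\in H(G_i)}f_i(t)\Bigr)\right)\in A.$$ In fact, the same holds for every idempotent $p$ of $(\mathcal{J}_p,+)$ (in place of a minimal idempotent).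
   Context: $\mathbb{N}$ is the set of positive integers; $\mathcal{P}_f(X)$ is the set of nonempty finite subsets of $X$; $\mathbb{N}^{\mathbb{N}}$ is the set of all functions $\mathbb{N}\to\mathbb{N}$. For $\beta,\gamma\in\mathcal{P}_f(\mathbb{N})$, $\beta<\gamma$ means $\max\beta<\min\gamma$. $\mathbb{P}$ is the set of one-variable polynomials with integer coefficients and zero constant term. $\beta\mathbb{N}$ is the set of ultrafilters on $\mathbb{N}$, with the Stone topology and the operation: $A\in p+q$ iff $\{x\in\mathbb{N}:-x+A\in q\}\in p$, where $-x+A=\{y\in\mathbb{N}:x+y\in A\}$. An ultrafilter $p$ is idempotent if $p+p=p$; a minimal idempotent is an idempotent lying in $K(\beta\mathbb{N},+)$, the smallest two-sided ideal (the union of all minimal left ideals) of $(\beta\mathbb{N},+)$. A set $A\subseteq\mathbb{N}$ is a $J_p$-set if for every $F\in\mathcal{P}_f(\mathbb{P})$ and every $H\in\mathcal{P}_f(\mathbb{N}^{\mathbb{N}})$ there exist $a\in\mathbb{N}$ and $\beta\in\mathcal{P}_f(\mathbb{N})$ such that $a+P(\sum_{t\in\beta}f(t))\in A$ for all $P\in F$ and $f\in H$. $\mathcal{J}_p=\{q\in\beta\mathbb{N}:\text{every }A\in q\text{ is a }J_p\text{-set}\}$ (the subscript $p$ stands for "polynomial" and is not an ultrafilter); it is a two-sided ideal of $(\beta\mathbb{N},+)$. Tensor products: for ultrafilters $p_1,\ldots,p_k$ on $\mathbb{N}$, $\bigotimes_{i=1}^k p_i$ is the ultrafilter on $\mathbb{N}^k$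 defined recursively by $\bigotimes_{i=1}^1p_i=p_1$, and, for $A\subseteq\mathbb{N}^{k+1}$, $A\in\bigotimes_{i=1}^{k+1}p_i$ iff $\{(x_1,\ldots,x_k)\in\mathbb{N}^k:\{x_{k+1}\in\mathbb{N}:(x_1,\ldots,x_{k+1})\in A\}\in p_{k+1}\}\in\bigotimes_{i=1}^kp_i$. $\bigotimes_{i=1}^mp$ is the case $p_i=p$ for all $i$. *)

theory Defs
  imports "HOL-Library.FuncSet" "HOL-Computational_Algebra.Polynomial"
begin

text \<open>
  The source's natural numbers are the positive integers, represented here by the carrier
  \<open>Npos\<close> inside the type \<^typ>\<open>nat\<close>.
\<close>

abbreviation Npos :: "nat set" where
  "Npos \<equiv> {n. 1 \<le> n}"

text \<open>
  Functions are taken from the extensional function space, so that two elements are equal iff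
  they agree on \<open>Npos\<close>; this matters because the theorem speaks about
  proper inclusions between finite sets of functions.
\<close>

abbreviation Npos_funs :: "(nat \<Rightarrow> nat) set" where
  "Npos_funs \<equiv> Npos \<rightarrow>\<^sub>E Npos"

definition Pf :: "'a set \<Rightarrow> 'a set set" where
  "Pf X = {F. F \<subseteq> X \<and> finite F \<and> F \<noteq> {}}"

definition set_before :: "nat set \<Rightarrow> nat set \<Rightarrow> bool" (infix "\<lless>" 50) where
  "\<beta> \<lless> \<gamma> \<longleftrightarrow> Max \<beta> < Min \<gamma>"

definition int_polys0 :: "int poly set" where
  "int_polys0 = {P. coeff P 0 = 0}"

definition ultrafilter_on :: "'a set \<Rightarrow> 'a set set \<Rightarrow> bool" where
  "ultrafilter_on X p \<longleftrightarrow>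
     p \<subseteq> Pow X \<and> X \<in> p \<and> {} \<notin> p \<and>
     (\<forall>A\<in>p. \<forall>B\<in>p. A \<inter> B \<in> p) \<and>
     (\<forall>A\<in>p. \<forall>B. A \<subseteq> B \<and> B \<subseteq> X \<longrightarrow> B \<in> p) \<and>
     (\<forall>A. A \<subseteq> X \<longrightarrow> A \<in> p \<or> X - A \<in> p)"

definition betaN :: "nat set set set" where
  "betaN = {p. ultrafilter_on Npos p}"

definition uf_add :: "nat set set \<Rightarrow> nat set set \<Rightarrow> nat set set" (infixl "\<oplus>\<^sub>\<beta>" 65) where
  "p \<oplus>\<^sub>\<beta> q = {A. A \<subseteq> Npos \<and> {x \<in> Npos. {y \<in> Npos. x + y \<in> A} \<in> q} \<in> p}"

definition two_sided_ideal :: "nat set set set \<Rightarrow> bool" where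
  "two_sided_ideal I \<longleftrightarrow>
     I \<subseteq> betaN \<and> I \<noteq> {} \<and>
     (\<forall>p\<in>betaN. \<forall>q\<in>I. p \<oplus>\<^sub>\<beta> q \<in> I \<and> q \<oplus>\<^sub>\<beta> p \<in> I)"

text \<open>The smallest two-sided ideal of \<open>betaN\<close>; ideals are nonempty by definition.\<close>

definition K_betaN :: "nat set set set" where
  "K_betaN = \<Inter> {I. two_sided_ideal I}"

definition idempotent_uf :: "nat set set \<Rightarrow> bool" where
  "idempotent_uf p \<longleftrightarrow> p \<in> betaN \<and> p \<oplus>\<^sub>\<beta> p = p"

definition minimal_idempotent :: "nat set set \<Rightarrow> bool" where
  "minimal_idempotent p \<longleftrightarrow> idempotent_uf p \<and> p \<in> K_betaN"

text \<open>
  Polynomial values are integers and may be negative, so membership in a set of positive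
  integers is membership in its image under \<^const>\<open>int\<close>.
\<close>

definition Jp_set :: "nat set \<Rightarrow> bool" where
  "Jp_set A \<longleftrightarrow> A \<subseteq> Npos \<and>
     (\<forall>F \<in> Pf int_polys0. \<forall>H \<in> Pf Npos_funs.
        \<exists>a \<in> Npos. \<exists>\<beta> \<in> Pf Npos. \<forall>P \<in> F. \<forall>f \<in> H.
          int a + poly P (int (\<Sum>t\<in>\<beta>. f t)) \<in> int ` A)"

definition Jp_ufs :: "nat set set set" where
  "Jp_ufs = {q \<in> betaN. \<forall>A \<in> q. Jp_set A}"

definition Npos_tuples :: "nat \<Rightarrow> nat list set" where
  "Npos_tuples k = {xs. length xs = k \<and> set xs \<subseteq> Npos}"

text \<open>
  \<open>tensor p k\<close> is the tensor product of \<open>p 1, \<dots>, p k\<close>, an ultrafilter on the \<open>k\<close>-tuples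
  (lists of length \<open>k\<close>).  It is meant for \<open>k \<ge> 1\<close>; the value at \<open>0\<close> is arbitrary.
\<close>

fun tensor :: "(nat \<Rightarrow> nat set set) \<Rightarrow> nat \<Rightarrow> nat list set set" where
  "tensor p 0 = {}"
| "tensor p (Suc 0) = {A. A \<subseteq> Npos_tuples 1 \<and> {x \<in> Npos. [x] \<in> A} \<in> p 1}"
| "tensor p (Suc (Suc k)) =
     {A. A \<subseteq> Npos_tuples (Suc (Suc k)) \<and>
         {xs \<in> Npos_tuples (Suc k). {x \<in> Npos. xs @ [x] \<in> A} \<in> p (Suc (Suc k))}
           \<in> tensor p (Suc k)}"

end

theory Submission
  imports Defs "HOL-Library.Multiset"
begin

text \<open>
  A polynomial IP van der Waerden theorem, proved by colour focusing and PET induction, shows that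
  the cells of a finite partition of the positive integers cannot all fail to be \<open>J\<^sub>p\<close>-sets. Hence
  the sets covered by finitely many non-\<open>J\<^sub>p\<close>-sets form a proper ideal, an ultrafilter avoiding it
  lies in \<^const>\<open>Jp_ufs\<close>, and this two-sided ideal contains \<^const>\<open>K_betaN\<close>. So \<open>p\<close> is an
  idempotent of \<^const>\<open>Jp_ufs\<close> in both cases.

  The functions \<open>\<alpha>\<close> and \<open>H\<close> are chosen by recursion on proper inclusion. Only finitely many
  partial tuples have been produced by chains below \<open>G\<close>, and each of them must stay inside finitely
  many sets \<open>B\<^sup>\<star> = {x \<in> B. -x + B \<in> p}\<close>. By idempotence \<open>-x + B\<^sup>\<star> \<in> p\<close> for \<open>x \<in> B\<^sup>\<star>\<close>. If
  \<open>x = u + P(s)\<close> is the value of an unfinished block, then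
  \<open>u + a + P(s + \<sigma>) = x + (a + Q(\<sigma>))\<close> with \<open>Q(\<sigma>) = P(s + \<sigma>) - P(s)\<close>, a polynomial without
  constant term. Applying the \<open>J\<^sub>p\<close> property to the intersection of the sets \<open>-x + B\<^sup>\<star>\<close> and these
  finitely many \<open>Q\<close> gives \<open>\<alpha>(G)\<close> and \<open>H(G)\<close>.
\<close>

subsection \<open>Polynomial IP van der Waerden theorem\<close>

text \<open>Degree at most \<open>d\<close> in the difference sense: all \<open>(d+1)\<close>-fold
  differences vanish. This makes sense over any commutative monoid, such as the multisets used
  later.\<close>

primrec poly_map :: "nat \<Rightarrow> ('a::comm_monoid_add \<Rightarrow> int) \<Rightarrow> bool" where
  "poly_map 0 g \<longleftrightarrow> (\<forall>x. g x = g 0)"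
| "poly_map (Suc d) g \<longleftrightarrow> (\<forall>v. poly_map d (\<lambda>x. g (x + v) - g x))"

lemma poly_map_const: "poly_map d (\<lambda>x. c)"
  by (induction d arbitrary: c) auto

lemma poly_map_Suc: "poly_map d g \<Longrightarrow> poly_map (Suc d) g"
proof (induction d arbitrary: g)
  case 0
  then have "g (x + v) - g x = 0" for x v
    by (metis cancel_comm_monoid_add_class.diff_cancel poly_map.simps(1))
  then show ?case by simp
qed auto

lemma poly_map_mono: "poly_map d g \<Longrightarrow> d \<le> e \<Longrightarrow> poly_map e g"
  by (induction e) (use poly_map_Suc le_Suc_eq in blast)+

lemma poly_map_add:
  "poly_map d g \<Longrightarrow> poly_map d h \<Longrightarrow> poly_map d (\<lambda>x. g x + h x)"
proof (induction d arbitrary: g h)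
  case 0
  then show ?case unfolding poly_map.simps(1) by metis
next
  case (Suc d)
  have "poly_map d (\<lambda>x. (g (x + v) - g x) + (h (x + v) - h x))" for v
    using Suc by auto
  then show ?case by (simp add: algebra_simps)
qed

lemma poly_map_diff:
  "poly_map d g \<Longrightarrow> poly_map d h \<Longrightarrow> poly_map d (\<lambda>x. g x - h x)"
proof (induction d arbitrary: g h)
  case 0
  then show ?case unfolding poly_map.simps(1) by metis
next
  case (Suc d)
  have "poly_map d (\<lambda>x. (g (x + v) - g x) - (h (x + v) - h x))" for v
    using Suc by auto
  then show ?case by (simp add: algebra_simps)
qed

lemma poly_map_translate: "poly_map d g \<Longrightarrow> poly_map d (\<lambda>x. g (x + w))"
proof (induction d arbitrary: g)
  case 0
  then show ?case unfolding poly_map.simps(1) by metis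
next
  case (Suc d)
  have "poly_map d (\<lambda>x. g (x + w + v) - g (x + w))" for v
    using Suc.IH[of "\<lambda>x. g (x + v) - g x"] Suc.prems by auto
  then show ?case by (simp add: add_ac)
qed

lemma poly_map_cmult: "poly_map d g \<Longrightarrow> poly_map d (\<lambda>x. c * g x)"
proof (induction d arbitrary: g)
  case 0
  then show ?case unfolding poly_map.simps(1) by metis
next
  case (Suc d)
  have "poly_map d (\<lambda>x. c * (g (x + v) - g x))" for v
    using Suc by auto
  then show ?case by (simp add: algebra_simps)
qed

text \<open>The difference of \<open>\<sigma> * h\<close> by \<open>v\<close> is
  \<open>\<sigma>\<close> times the difference of \<open>h\<close> plus the constant
  \<open>\<sigma> v\<close> times a translate of \<open>h\<close>; induction bounds the first
  part.\<close>

lemma poly_map_mult_additive: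
  assumes add: "\<And>x y. \<sigma> (x + y) = \<sigma> x + \<sigma> y"
  shows "poly_map d h \<Longrightarrow> poly_map (Suc d) (\<lambda>x. \<sigma> x * h x)"
proof (induction d arbitrary: h)
  case 0
  then have h: "h x = h 0" for x by auto
  have "\<sigma> (x + v) * h (x + v) - \<sigma> x * h x = \<sigma> v * h 0" for x v
    by (subst h, subst h[of x]) (simp add: add algebra_simps)
  then show ?case by simp
next
  case (Suc d)
  have "poly_map (Suc d) (\<lambda>x. \<sigma> (x + v) * h (x + v) - \<sigma> x * h x)" for v
  proof -
    have 1: "poly_map (Suc d) (\<lambda>x. \<sigma> x * (h (x + v) - h x))"
      using Suc by auto
    have "poly_map (Suc d) (\<lambda>x. c * h (x + v))" for c :: int
      using poly_map_cmult[OF poly_map_translate[OF Suc.prems]] .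
    then have "poly_map (Suc d) (\<lambda>x. \<sigma> x * (h (x + v) - h x) + \<sigma> v * h (x + v))"
      using 1 poly_map_add by blast
    then show ?thesis by (simp add: add algebra_simps)
  qed
  then show ?case by simp
qed

lemma poly_map_poly:
  assumes add: "\<And>x y. \<sigma> (x + y) = \<sigma> x + \<sigma> y"
  shows "\<exists>d. poly_map d (\<lambda>x. poly P (\<sigma> x))"
proof (induction P)
  case 0
  show ?case using poly_map_const by auto
next
  case (pCons a P)
  then obtain d where "poly_map d (\<lambda>x. poly P (\<sigma> x))" by blast
  then have "poly_map (Suc d) (\<lambda>x. a + \<sigma> x * poly P (\<sigma> x))"
    using poly_map_mult_additive[OF add] poly_map_const poly_map_add by blast
  then show ?case unfolding poly_pCons by blast
qed

section \<open>Monochromatic polynomial configurations over finite sums\<close>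

text \<open>The bound \<open>M\<close> precedes the colouring, since the focusing argument needs one
  bound for all colourings. Colouring all integers avoids sign conditions on the values of the
  maps.\<close>

definition IP_vdw :: "('a::comm_monoid_add \<Rightarrow> int) set \<Rightarrow> bool" where
  "IP_vdw A \<longleftrightarrow> (\<forall>r. \<forall>s :: nat \<Rightarrow> 'a. \<exists>M. \<forall>c :: int \<Rightarrow> nat. (\<forall>x. c x < r) \<longrightarrow>
     (\<exists>a \<beta>. \<bar>a\<bar> \<le> int M \<and> \<beta> \<noteq> {} \<and> \<beta> \<subseteq> {..<M} \<and>
       (\<forall>g\<in>A. c (a + g (sum s \<beta>)) = c a)))"

text \<open>The zero map demands nothing. Discarding it lets the later induction end at the empty
  family.\<close>

lemma IP_vdw_remove_zero:
  assumes "IP_vdw (A - {\<lambda>_. 0})"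
  shows "IP_vdw A"
  unfolding IP_vdw_def
proof (intro allI)
  fix r and s :: "nat \<Rightarrow> 'a"
  obtain M where M: "\<And>c :: int \<Rightarrow> nat. (\<forall>x. c x < r) \<Longrightarrow>
     (\<exists>a \<beta>. \<bar>a\<bar> \<le> int M \<and> \<beta> \<noteq> {} \<and> \<beta> \<subseteq> {..<M} \<and>
       (\<forall>g\<in>A - {\<lambda>_. 0}. c (a + g (sum s \<beta>)) = c a))"
    using assms[unfolded IP_vdw_def, THEN spec, of r, THEN spec, of s] by blast
  show "\<exists>M. \<forall>c :: int \<Rightarrow> nat. (\<forall>x. c x < r) \<longrightarrow>
     (\<exists>a \<beta>. \<bar>a\<bar> \<le> int M \<and> \<beta> \<noteq> {} \<and> \<beta> \<subseteq> {..<M} \<and>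
       (\<forall>g\<in>A. c (a + g (sum s \<beta>)) = c a))"
  proof (intro exI[of _ M] allI impI)
    fix c :: "int \<Rightarrow> nat"
    assume "\<forall>x. c x < r"
    from M[OF this] obtain a \<beta> where *: "\<bar>a\<bar> \<le> int M" "\<beta> \<noteq> {}" "\<beta> \<subseteq> {..<M}"
      "\<forall>g\<in>A - {\<lambda>_. 0}. c (a + g (sum s \<beta>)) = c a" by blast
    have "c (a + g (sum s \<beta>)) = c a" if "g \<in> A" for g
      using *(4) that by (cases "g = (\<lambda>_. 0)") auto
    then show "\<exists>a \<beta>. \<bar>a\<bar> \<le> int M \<and> \<beta> \<noteq> {} \<and> \<beta> \<subseteq> {..<M} \<and>
       (\<forall>g\<in>A. c (a + g (sum s \<beta>)) = c a)" using *(1-3) by blast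
  qed
qed

lemma IP_vdw_empty: "IP_vdw {}"
  unfolding IP_vdw_def
proof (rule allI, rule allI, rule exI[of _ 1], intro allI impI)
  show "\<exists>a \<beta>. \<bar>a\<bar> \<le> int 1 \<and> \<beta> \<noteq> {} \<and> \<beta> \<subseteq> {..<1} \<and>
     (\<forall>g\<in>{}. c (a + g (sum s \<beta>)) = c a)" for c :: "int \<Rightarrow> nat" and s :: "nat \<Rightarrow> 'a"
    by (rule exI[of _ 0], rule exI[of _ "{0}"]) auto
qed

lemma finite_int_bound:
  fixes S :: "int set"
  assumes "finite S"
  obtains K :: nat where "\<And>x. x \<in> S \<Longrightarrow> \<bar>x\<bar> \<le> int K"
proof -
  have "\<bar>x\<bar> \<le> int (Max (insert 0 ((nat \<circ> abs) ` S)))" if "x \<in> S" for x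
  proof -
    have "(nat \<circ> abs) x \<le> Max (insert 0 ((nat \<circ> abs) ` S))"
      using assms that by (intro Max_ge) auto
    then show ?thesis by simp
  qed
  then show thesis using that by blast
qed

text \<open>\<open>code c x\<close> numbers the pattern of \<open>c\<close> on the translate of
  \<open>D\<close> by \<open>x\<close>. The patterns form a finite function space, so their number
  \<open>R\<close> is fixed before \<open>c\<close>.\<close>

lemma finite_block_colouring:
  fixes c :: "int \<Rightarrow> nat" and D :: "int set"
  assumes "finite D"
  obtains R code where "\<And>c :: int \<Rightarrow> nat. (\<forall>x. c x < r) \<Longrightarrow> (\<forall>x. code c x < (R::nat))"
    and "\<And>(c :: int \<Rightarrow> nat) x y d. (\<forall>x. c x < r) \<Longrightarrow> code c x = code c y \<Longrightarrow> d \<in> D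
      \<Longrightarrow> c (x + d) = c (y + d)"
proof -
  define \<Phi> where "\<Phi> = D \<rightarrow>\<^sub>E {..<r}"
  have "finite \<Phi>" unfolding \<Phi>_def using assms by (intro finite_PiE) auto
  then obtain e :: "(int \<Rightarrow> nat) \<Rightarrow> nat" and R where e: "e ` \<Phi> = {i. i < R}" "inj_on e \<Phi>"
    using finite_imp_inj_to_nat_seg by blast
  define code where "code c x = e (\<lambda>d\<in>D. c (x + d))" for c :: "int \<Rightarrow> nat" and x
  have mem: "(\<lambda>d\<in>D. c (x + d)) \<in> \<Phi>" if "\<forall>x. c x < r" for c x
    using that unfolding \<Phi>_def by auto
  show thesis
  proof (rule that[of code R])
    show "\<forall>x. code c x < R" if "\<forall>x. c x < r" for c
      using mem[OF that] e(1) unfolding code_def by auto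
    show "c (x + d) = c (y + d)"
      if c: "\<forall>x. c x < r" and eq: "code c x = code c y" and "d \<in> D" for c x y d
    proof -
      have "(\<lambda>d\<in>D. c (x + d)) = (\<lambda>d\<in>D. c (y + d))"
        using e(2) mem[OF c] eq unfolding code_def inj_on_def by blast
      from fun_cong[OF this, of d] show ?thesis using \<open>d \<in> D\<close> by simp
    qed
  qed
qed

text \<open>
  Colour focusing: for \<open>k\<close> increasing up to the number of colours one finds a point \<open>a\<close> and sets
  \<open>B j\<close> such that the values \<open>a + g (sum s (B j))\<close>, \<open>g \<in> A\<close>, share a colour \<open>\<kappa> j\<close>, with the
  \<open>\<kappa> j\<close> distinct and different from the colour of \<open>a\<close>. Here \<open>h\<close> is subtracted to move
  the focus from \<open>a\<close> to \<open>a - h w\<close>.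
\<close>

lemma IP_vdw_focusing:
  fixes A :: "('a::comm_monoid_add \<Rightarrow> int) set"
  assumes A: "finite A" "\<And>g. g \<in> A \<Longrightarrow> g 0 = 0"
    and derived: "\<And>V. finite V \<Longrightarrow> IP_vdw ((\<lambda>(g, v) x. g (x + v) - g v - h x) ` (A \<times> V))"
  shows "IP_vdw A"
  unfolding IP_vdw_def
proof (intro allI)
  fix r and s :: "nat \<Rightarrow> 'a"
  define mono where "mono N c \<longleftrightarrow> (\<exists>a \<beta>. \<bar>a\<bar> \<le> int N \<and> \<beta> \<noteq> {} \<and> \<beta> \<subseteq> {..<N} \<and>
      (\<forall>g\<in>A. c (a + g (sum s \<beta>)) = c a))" for N and c :: "int \<Rightarrow> nat"
  define focused where "focused N c k \<longleftrightarrow> (\<exists>a B \<kappa>. \<bar>a\<bar> \<le> int N \<and>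
      (\<forall>j<k. B j \<noteq> {} \<and> B j \<subseteq> {..<N} \<and> \<kappa> j < r \<and> (\<forall>g\<in>A. c (a + g (sum s (B j))) = \<kappa> j)) \<and>
      inj_on \<kappa> {..<k} \<and> c a \<notin> \<kappa> ` {..<k})" for N and c :: "int \<Rightarrow> nat" and k :: nat
  have "\<exists>N. \<forall>c. (\<forall>x. c x < r) \<longrightarrow> mono N c \<or> focused N c k" for k
  proof (induction k)
    case 0
    have "focused 0 c 0" for c unfolding focused_def by auto
    then show ?case by blast
  next
    case (Suc k)
    then obtain N where N: "\<And>c. \<forall>x. c x < r \<Longrightarrow> mono N c \<or> focused N c k" by blast
    \<comment> \<open>\<open>V\<close> holds the sums over old index sets and \<open>D\<close> the
      displacements that a configuration of size \<open>N\<close> can inspect, so one code records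
      all its colours.\<close>
    define V where "V = sum s ` Pow {..<N}"
    have V: "finite V" unfolding V_def by auto
    define D where "D = (\<lambda>(a, g, v). a + g v) ` ({-int N..int N} \<times> A \<times> V)"
    have "finite D" unfolding D_def using A V by auto
    then obtain R code where
      code: "\<And>c :: int \<Rightarrow> nat. (\<forall>x. c x < r) \<Longrightarrow> (\<forall>x. code c x < (R::nat))"
        "\<And>(c :: int \<Rightarrow> nat) x y d. (\<forall>x. c x < r) \<Longrightarrow> code c x = code c y \<Longrightarrow> d \<in> D
        \<Longrightarrow> c (x + d) = c (y + d)"
      by (rule finite_block_colouring[of D r]) blast
    \<comment> \<open>The sequence is shifted by \<open>N\<close> so that the new indices lie beyond
      the old ones and sums over unions split.\<close>
    obtain M where M: "\<And>c :: int \<Rightarrow> nat. (\<forall>x. c x < R) \<Longrightarrow>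
       (\<exists>b \<gamma>. \<bar>b\<bar> \<le> int M \<and> \<gamma> \<noteq> {} \<and> \<gamma> \<subseteq> {..<M} \<and>
         (\<forall>q\<in>(\<lambda>(g, v) x. g (x + v) - g v - h x) ` (A \<times> V).
            c (b + q (sum (\<lambda>t. s (N + t)) \<gamma>)) = c b))"
      using derived[OF V, unfolded IP_vdw_def, THEN spec, of R, THEN spec, of "\<lambda>t. s (N + t)"]
      by blast
    obtain K where K: "\<And>x. x \<in> (\<lambda>\<gamma>. h (sum (\<lambda>t. s (N + t)) \<gamma>)) ` Pow {..<M} \<Longrightarrow> \<bar>x\<bar> \<le> int K"
      by (rule finite_int_bound[of "(\<lambda>\<gamma>. h (sum (\<lambda>t. s (N + t)) \<gamma>)) ` Pow {..<M}"]) auto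
    have "mono (N + M + K) c \<or> focused (N + M + K) c (Suc k)" if c: "\<forall>x. c x < r" for c
    proof (rule disjCI)
      assume not_focused: "\<not> focused (N + M + K) c (Suc k)"
      obtain b \<gamma> where b: "\<bar>b\<bar> \<le> int M" "\<gamma> \<noteq> {}" "\<gamma> \<subseteq> {..<M}"
        and same: "\<forall>q\<in>(\<lambda>(g, v) x. g (x + v) - g v - h x) ` (A \<times> V).
            code c (b + q (sum (\<lambda>t. s (N + t)) \<gamma>)) = code c b"
        using M[OF code(1)[OF c]] by (elim exE conjE) (rule that)
      define G where "G = (\<lambda>t. N + t) ` \<gamma>"
      define w where "w = sum s G"
      have w: "w = sum (\<lambda>t. s (N + t)) \<gamma>"
        unfolding w_def G_def by (subst sum.reindex) (auto simp: o_def)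
      have G: "finite G" "G \<noteq> {}" "G \<subseteq> {..<N + M}" "G \<inter> {..<N} = {}"
        using b finite_subset[OF b(3)] unfolding G_def by auto
      have hw: "\<bar>h w\<bar> \<le> int K" using K b(3) unfolding w by blast
      \<comment> \<open>For \<open>q\<close> in the derived family, \<open>b + q w\<close> and
        \<open>b\<close> have the same code; comparing both at the displacement
        \<open>a + g v\<close> gives the claim.\<close>
      have shift: "c (b + a - h w + g (v + w)) = c (b + a + g v)"
        if "g \<in> A" "v \<in> V" "\<bar>a\<bar> \<le> int N" for a g v
      proof -
        have D: "a + g v \<in> D" unfolding D_def using that
          by (intro image_eqI[of _ _ "(a, g, v)"]) auto
        have "(\<lambda>x. g (x + v) - g v - h x) \<in> (\<lambda>(g, v) x. g (x + v) - g v - h x) ` (A \<times> V)"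
          using that by (intro image_eqI[of _ _ "(g, v)"]) auto
        from bspec[OF same this] have "code c (b + (g (w + v) - g v - h w)) = code c b"
          unfolding w by simp
        from code(2)[OF c this D]
        have "c (b + (g (w + v) - g v - h w) + (a + g v)) = c (b + (a + g v))" .
        then show ?thesis by (simp add: algebra_simps)
      qed
      have "\<forall>x. c (b + x) < r" using c by auto
      from N[OF this] show "mono (N + M + K) c"
      proof
        assume "mono N (\<lambda>x. c (b + x))"
        then obtain a \<beta> where "\<bar>a\<bar> \<le> int N" "\<beta> \<noteq> {}" "\<beta> \<subseteq> {..<N}"
          "\<forall>g\<in>A. c (b + (a + g (sum s \<beta>))) = c (b + a)" unfolding mono_def by blast
        then show ?thesis unfolding mono_def using b
          by (intro exI[of _ "b + a"] exI[of _ \<beta>]) (auto simp: add.assoc)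
      next
        assume "focused N (\<lambda>x. c (b + x)) k"
        then obtain a B \<kappa> where a: "\<bar>a\<bar> \<le> int N"
          and B: "\<And>j. j < k \<Longrightarrow> B j \<noteq> {} \<and> B j \<subseteq> {..<N} \<and> \<kappa> j < r \<and>
             (\<forall>g\<in>A. c (b + (a + g (sum s (B j)))) = \<kappa> j)"
          and inj: "inj_on \<kappa> {..<k}" and ca: "c (b + a) \<notin> \<kappa> ` {..<k}"
          unfolding focused_def by blast
        \<comment> \<open>The enlarged sets \<open>B j \<union> G\<close> keep their colours. The
          set \<open>G\<close> alone contributes the colour of the old focus, by the case
          \<open>v = 0\<close> with \<open>g 0 = 0\<close>.\<close>
        define a' where "a' = b + a - h w"
        define B' where "B' j = (if j < k then B j \<union> G else G)" for j
        define \<kappa>' where "\<kappa>' = \<kappa>(k := c (b + a))"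
        have a': "\<bar>a'\<bar> \<le> int (N + M + K)" unfolding a'_def using a b(1) hw by linarith
        have B': "B' j \<noteq> {} \<and> B' j \<subseteq> {..<N + M + K} \<and> \<kappa>' j < r \<and>
             (\<forall>g\<in>A. c (a' + g (sum s (B' j))) = \<kappa>' j)" if "j < Suc k" for j
        proof (cases "j < k")
          case True
          have "sum s (B' j) = sum s (B j) + w"
            unfolding B'_def w_def using True B[OF True] G
            by (auto intro!: sum.union_disjoint dest: finite_subset[of _ "{..<N}"])
          moreover have "sum s (B j) \<in> V" using B[OF True] unfolding V_def by auto
          ultimately have "c (a' + g (sum s (B' j))) = c (b + a + g (sum s (B j)))" if "g \<in> A" for g
            using shift[OF that _ a] unfolding a'_def by simp
          moreover have "B' j \<noteq> {} \<and> B' j \<subseteq> {..<N + M + K}"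
            using B[OF True] G True unfolding B'_def by fastforce
          ultimately show ?thesis using B[OF True] True by (auto simp: \<kappa>'_def add.assoc)
        next
          case False
          then have "j = k" using that by simp
          have "0 \<in> V" unfolding V_def by (intro image_eqI[of _ _ "{}"]) auto
          then have "c (a' + g (sum s (B' j))) = c (b + a)" if "g \<in> A" for g
            using shift[OF that _ a, of 0] A(2)[OF that] \<open>j = k\<close>
            unfolding a'_def B'_def w_def by simp
          then show ?thesis using G c \<open>j = k\<close> unfolding B'_def \<kappa>'_def by fastforce
        qed
        have inj': "inj_on \<kappa>' {..<Suc k}"
          using inj ca unfolding \<kappa>'_def lessThan_Suc inj_on_insert
          by (auto simp: fun_upd_image intro!: inj_on_fun_updI)
        have "c a' \<in> \<kappa>' ` {..<Suc k}"
        proof (rule ccontr)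
          assume "c a' \<notin> \<kappa>' ` {..<Suc k}"
          then have "focused (N + M + K) c (Suc k)"
            unfolding focused_def using a' B' inj'
            by (intro exI[of _ a'] exI[of _ B'] exI[of _ \<kappa>'] conjI allI impI) auto
          then show False using not_focused by blast
        qed
        then obtain j where j: "j < Suc k" "c a' = \<kappa>' j" by auto
        then have "\<forall>g\<in>A. c (a' + g (sum s (B' j))) = c a'" using B'[OF j(1)] by simp
        then show ?thesis unfolding mono_def using B'[OF j(1)] a' by blast
      qed
    qed
    then show ?case by (intro exI[of _ "N + M + K"]) blast
  qed
  from this[of r] obtain N where N: "\<And>c. \<forall>x. c x < r \<Longrightarrow> mono N c \<or> focused N c r" by blast
  have "mono N c" if c: "\<forall>x. c x < r" for c
  proof (rule ccontr)
    assume "\<not> mono N c"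
    then obtain a \<kappa> where \<kappa>: "\<forall>j<r. \<kappa> j < r" "inj_on \<kappa> {..<r}" "c a \<notin> \<kappa> ` {..<r}"
      using N[OF c] unfolding focused_def by blast
    then have "\<kappa> ` {..<r} = {..<r}" by (intro endo_inj_surj) auto
    then show False using \<kappa>(3) c by auto
  qed
  then show "\<exists>M. \<forall>c :: int \<Rightarrow> nat. (\<forall>x. c x < r) \<longrightarrow>
     (\<exists>a \<beta>. \<bar>a\<bar> \<le> int M \<and> \<beta> \<noteq> {} \<and> \<beta> \<subseteq> {..<M} \<and>
       (\<forall>g\<in>A. c (a + g (sum s \<beta>)) = c a))"
    unfolding mono_def by (intro exI[of _ N] allI impI)
qed

text \<open>
  PET induction. A pair \<open>(l, d)\<close> in \<open>L\<close> stands for the class of polynomial maps of degree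
  \<open>d + 1\<close> that differ from \<open>l\<close> by a map of degree at most \<open>d\<close>. Passing to the derived system with
  \<open>h\<close> from a class of least degree replaces this class by finitely many of smaller degree and leaves
  the degrees of all others unchanged, so the multiset of degrees decreases.
\<close>

lemma IP_vdw_poly_map_leaders:
  fixes L :: "(('a::comm_monoid_add \<Rightarrow> int) \<times> nat) multiset"
  assumes "finite A" "\<And>g. g \<in> A \<Longrightarrow> g 0 = 0"
    and "\<And>l d. (l, d) \<in># L \<Longrightarrow> poly_map (Suc d) l"
    and "\<And>g. g \<in> A \<Longrightarrow> g \<noteq> (\<lambda>_. 0) \<Longrightarrow> \<exists>(l, d) \<in># L. poly_map d (\<lambda>x. g x - l x)"
  shows "IP_vdw A"
  \<comment> \<open>One step of the multiset order is enough: a single degree is replaced by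
    finitely many smaller ones, possibly by none.\<close>
  using wf_mult1[OF wf_less_than] assms
proof (induction "image_mset snd L" arbitrary: L A rule: wf_induct_rule)
  case less
  define A' where "A' = A - {\<lambda>_. 0}"
  have A': "finite A'" "\<And>g. g \<in> A' \<Longrightarrow> g 0 = 0"
    and A'_L: "\<And>g. g \<in> A' \<Longrightarrow> \<exists>(l, d) \<in># L. poly_map d (\<lambda>x. g x - l x)"
    using less.prems unfolding A'_def by auto
  have "IP_vdw A'"
  proof (cases "A' = {}")
    case True
    then show ?thesis using IP_vdw_empty by simp
  next
    case False
    then have "L \<noteq> {#}" using A'_L by fastforce
    then have "snd ` set_mset L \<noteq> {}" by simp
    then have "Min (snd ` set_mset L) \<in> snd ` set_mset L" by (intro Min_in) auto
    then obtain l d where ld: "(l, d) \<in># L" "d = Min (snd ` set_mset L)"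
      unfolding image_iff Bex_def by (metis prod.collapse)
    have d_le: "d \<le> e" if "(l', e) \<in># L" for l' e
      using that unfolding ld(2) by (intro Min_le) (auto intro: rev_image_eqI)
    obtain L0 where L: "L = add_mset (l, d) L0" using multi_member_split[OF ld(1)] by blast
    show ?thesis
    proof (cases "\<exists>h\<in>A'. poly_map d (\<lambda>x. h x - l x)")
      case False
      show ?thesis
      proof (rule less.hyps[of L0 A'])
        show "(image_mset snd L0, image_mset snd L) \<in> mult1 less_than"
          unfolding L by (intro mult1I[of _ d _ _ "{#}"]) auto
        show "\<exists>(l, d) \<in># L0. poly_map d (\<lambda>x. g x - l x)" if "g \<in> A'" for g
          using A'_L[OF that] False that unfolding L by auto
      qed (use A' less.prems L in auto)
    next
      case True
      then obtain h where h: "h \<in> A'" "poly_map d (\<lambda>x. h x - l x)" by blast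
      have "poly_map (Suc d) (\<lambda>x. l x + (h x - l x))"
        using less.prems(3)[OF ld(1)] poly_map_Suc[OF h(2)] by (rule poly_map_add)
      then have h_deg: "poly_map (Suc d) h" by simp
      show ?thesis
      proof (rule IP_vdw_focusing[where A = A' and h = h])
        fix V :: "'a set"
        assume V: "finite V"
        define B where "B = (\<lambda>(g, v) x. g (x + v) - g v - h x) ` (A' \<times> V)"
        define B1 where "B1 = {b \<in> B. poly_map d b}"
        have fin: "finite B" "finite B1" unfolding B1_def B_def using A'(1) V by auto
        \<comment> \<open>Leaders other than \<open>(l, d)\<close> are shifted by \<open>h\<close>,
          which respects their degree bounds by the minimality of \<open>d\<close>. Derived maps of
          degree at most \<open>d\<close> become their own leaders one class lower; for
          \<open>d = 0\<close> they vanish, being constant and zero at \<open>0\<close>.\<close>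
        define L1 where "L1 = image_mset (\<lambda>(l', e). (\<lambda>x. l' x - h x, e)) L0"
        define L2 where "L2 = (if d = 0 then {#} else image_mset (\<lambda>b. (b, d - 1)) (mset_set B1))"
        have B0: "b 0 = 0" if "b \<in> B" for b
          using that A'(2) h(1) unfolding B_def by auto
        have "IP_vdw B"
        proof (rule less.hyps[of "L1 + L2" B])
          have "image_mset snd L1 = image_mset snd L0"
            unfolding L1_def by (simp add: multiset.map_comp o_def case_prod_unfold)
          then show "(image_mset snd (L1 + L2), image_mset snd L) \<in> mult1 less_than"
            unfolding L by (intro mult1I[of _ d _ _ "image_mset snd L2"]) (auto simp: L2_def split: if_splits)
          show "poly_map (Suc e) l'" if le: "(l', e) \<in># L1 + L2" for l' e
          proof -
            consider "(l', e) \<in># L1" | "(l', e) \<in># L2" using le by auto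
            then show ?thesis
            proof cases
              case 1
              then obtain l0 where l0: "(l0, e) \<in># L0" "l' = (\<lambda>x. l0 x - h x)"
                unfolding L1_def by auto
              then have "(l0, e) \<in># L" unfolding L by simp
              then have "poly_map (Suc e) l0" "poly_map (Suc e) h"
                using less.prems(3) d_le poly_map_mono[OF h_deg, of "Suc e"] by blast+
              then show ?thesis unfolding l0 by (rule poly_map_diff)
            next
              case 2
              then have "poly_map d l'" "Suc e = d"
                using fin unfolding L2_def B1_def by (auto split: if_splits)
              then show ?thesis by blast
            qed
          qed
          show "\<exists>(l', e) \<in># L1 + L2. poly_map e (\<lambda>x. b x - l' x)"
            if b: "b \<in> B" "b \<noteq> (\<lambda>_. 0)" for b
          proof -
            obtain g v where g: "g \<in> A'" and b_eq: "b = (\<lambda>x. g (x + v) - g v - h x)"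
              using b unfolding B_def by auto
            obtain l' e where l': "(l', e) \<in># L" "poly_map e (\<lambda>x. g x - l' x)"
              using A'_L[OF g] by auto
            have "poly_map (Suc e) (\<lambda>x. l' x + (g x - l' x))"
              using less.prems(3)[OF l'(1)] poly_map_Suc[OF l'(2)] by (rule poly_map_add)
            then have "poly_map e (\<lambda>x. g (x + v) - g x)" by simp
            then have "poly_map e (\<lambda>x. (g (x + v) - g x) - g v)"
              using poly_map_const by (rule poly_map_diff)
            from poly_map_add[OF this l'(2)]
            have diff: "poly_map e (\<lambda>x. g (x + v) - g v - l' x)"
              by (simp add: algebra_simps)
            show ?thesis
            proof (cases "(l', e) \<in># L0")
              case True
              have "(\<lambda>x. l' x - h x, e) \<in># L1"
                using True unfolding L1_def by force
              moreover have "poly_map e (\<lambda>x. b x - (l' x - h x))"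
                using diff unfolding b_eq by (simp add: algebra_simps)
              ultimately show ?thesis by auto
            next
              case False
              then have eq: "l' = l" "e = d" using l'(1) unfolding L by auto
              have "poly_map d (\<lambda>x. (g (x + v) - g v - l x) - (h x - l x))"
                using poly_map_diff[OF diff[unfolded eq] h(2)] .
              then have db: "poly_map d b" unfolding b_eq by (simp add: algebra_simps)
              have "d \<noteq> 0"
              proof
                assume "d = 0"
                then have "b = (\<lambda>_. 0)" using db B0[OF b(1)] by auto
                then show False using b(2) by simp
              qed
              then have "(b, d - 1) \<in># L2"
                using db b(1) fin unfolding L2_def B1_def by auto
              moreover have "poly_map (d - 1) (\<lambda>x. b x - b x)"
                using poly_map_const by auto
              ultimately show ?thesis by (intro bexI[of _ "(b, d - 1)"]) auto
            qed
          qed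
        qed (use fin B0 in auto)
        then show "IP_vdw ((\<lambda>(g, v) x. g (x + v) - g v - h x) ` (A' \<times> V))"
          unfolding B_def .
      qed (use A' in auto)
    qed
  qed
  then show ?case unfolding A'_def by (rule IP_vdw_remove_zero)
qed

theorem IP_vdw_poly_map:
  fixes A :: "('a::comm_monoid_add \<Rightarrow> int) set"
  assumes "finite A" "\<And>g. g \<in> A \<Longrightarrow> g 0 = 0 \<and> (\<exists>d. poly_map d g)"
  shows "IP_vdw A"
proof -
  obtain deg where deg: "\<And>g. g \<in> A \<Longrightarrow> poly_map (deg g) g"
    using assms(2) by metis
  show ?thesis
  proof (rule IP_vdw_poly_map_leaders[of A "image_mset (\<lambda>g. (g, deg g)) (mset_set A)"])
    show "poly_map (Suc d) l" if "(l, d) \<in># image_mset (\<lambda>g. (g, deg g)) (mset_set A)" for l d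
      using that assms(1) deg poly_map_Suc by auto
    show "\<exists>(l, d) \<in># image_mset (\<lambda>g. (g, deg g)) (mset_set A). poly_map d (\<lambda>x. g x - l x)"
      if "g \<in> A" for g
      using that assms(1) poly_map_const[of "deg g" 0] by (intro bexI[of _ "(g, deg g)"]) auto
  qed (use assms in auto)
qed

subsection \<open>Ultrafilters of \<open>J\<^sub>p\<close>-sets\<close>

lemma ultrafilter_avoiding_ideal:
  fixes I :: "'a set set"
  assumes I: "X \<notin> I" "{} \<in> I" "\<And>A B. A \<in> I \<Longrightarrow> B \<in> I \<Longrightarrow> A \<union> B \<in> I"
    "\<And>A B. A \<in> I \<Longrightarrow> B \<subseteq> A \<Longrightarrow> B \<in> I"
  shows "\<exists>p. ultrafilter_on X p \<and> p \<inter> I = {}"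
proof -
  define \<I> where "\<I> = {J. I \<subseteq> J \<and> X \<notin> J \<and> (\<forall>A\<in>J. \<forall>B\<in>J. A \<union> B \<in> J) \<and>
    (\<forall>A\<in>J. \<forall>B\<subseteq>A. B \<in> J)}"
  have "I \<in> \<I>" unfolding \<I>_def using I by blast
  have "\<Union>\<C> \<in> \<I>" if ne: "\<C> \<noteq> {}" and chain: "subset.chain \<I> \<C>" for \<C>
  proof -
    have C: "\<C> \<subseteq> \<I>" "\<And>J K. J \<in> \<C> \<Longrightarrow> K \<in> \<C> \<Longrightarrow> J \<subseteq> K \<or> K \<subseteq> J"
      using chain unfolding subset_chain_def by blast+
    have "A \<union> B \<in> \<Union>\<C>" if AB: "A \<in> \<Union>\<C>" "B \<in> \<Union>\<C>" for A B
    proof -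
      obtain J where J: "J \<in> \<C>" "A \<in> J" "B \<in> J" using AB C(2) by blast
      then have "A \<union> B \<in> J" using C(1) unfolding \<I>_def by blast
      then show ?thesis using J(1) by blast
    qed
    then have un: "\<forall>A\<in>\<Union>\<C>. \<forall>B\<in>\<Union>\<C>. A \<union> B \<in> \<Union>\<C>" by blast
    have *: "I \<subseteq> J" "X \<notin> J" "\<forall>A\<in>J. \<forall>B\<subseteq>A. B \<in> J" if "J \<in> \<C>" for J
      using subsetD[OF C(1) that] unfolding \<I>_def by simp_all
    have I: "I \<subseteq> \<Union>\<C>" using *(1) ne by blast
    have "X \<notin> \<Union>\<C>" using *(2) by blast
    moreover have "\<forall>A\<in>\<Union>\<C>. \<forall>B\<subseteq>A. B \<in> \<Union>\<C>" using *(3) by (meson Union_iff)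
    ultimately show ?thesis unfolding \<I>_def using I un by simp
  qed
  with \<open>I \<in> \<I>\<close> have "\<exists>J\<in>\<I>. \<forall>K\<in>\<I>. J \<subseteq> K \<longrightarrow> K = J"
    by (intro subset_Zorn_nonempty) auto
  then obtain J where J: "J \<in> \<I>" and max: "\<And>K. K \<in> \<I> \<Longrightarrow> J \<subseteq> K \<Longrightarrow> K = J" by auto
  have J': "I \<subseteq> J" "X \<notin> J" "\<And>A B. A \<in> J \<Longrightarrow> B \<in> J \<Longrightarrow> A \<union> B \<in> J"
    "\<And>A B. A \<in> J \<Longrightarrow> B \<subseteq> A \<Longrightarrow> B \<in> J" using J unfolding \<I>_def by simp_all
  have dichotomy: "A \<in> J \<or> X - A \<in> J" if "A \<subseteq> X" for A
  proof (rule disjCI)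
    assume nA: "X - A \<notin> J"
    define K where "K = {B. \<exists>C\<in>J. B \<subseteq> A \<union> C}"
    have "J \<subseteq> K" unfolding K_def by blast
    moreover have "X \<notin> K"
    proof
      assume "X \<in> K"
      then obtain C where "C \<in> J" "X - A \<subseteq> C" unfolding K_def by blast
      then show False using nA J'(4) by blast
    qed
    moreover have "B1 \<union> B2 \<in> K" if "B1 \<in> K" "B2 \<in> K" for B1 B2
    proof -
      obtain C1 C2 where "C1 \<in> J" "C2 \<in> J" "B1 \<subseteq> A \<union> C1" "B2 \<subseteq> A \<union> C2"
        using \<open>B1 \<in> K\<close> \<open>B2 \<in> K\<close> unfolding K_def by blast
      then have "C1 \<union> C2 \<in> J" "B1 \<union> B2 \<subseteq> A \<union> (C1 \<union> C2)" using J'(3) by blast+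
      then show ?thesis unfolding K_def by blast
    qed
    moreover have "\<forall>B\<in>K. \<forall>B'\<subseteq>B. B' \<in> K" unfolding K_def by blast
    moreover have "I \<subseteq> K" using J'(1) \<open>J \<subseteq> K\<close> by (rule subset_trans)
    ultimately have "K \<in> \<I>" unfolding \<I>_def by simp
    then have "K = J" using max \<open>J \<subseteq> K\<close> by blast
    moreover have "A \<in> K" unfolding K_def using subsetD[OF J'(1) I(2)] by auto
    ultimately show "A \<in> J" by simp
  qed
  define p where "p = {A. A \<subseteq> X \<and> X - A \<in> J}"
  have "ultrafilter_on X p"
    unfolding ultrafilter_on_def
  proof (intro conjI ballI allI impI)
    show "X \<in> p" unfolding p_def using I(2) J'(1) by auto
    show "A \<inter> B \<in> p" if "A \<in> p" "B \<in> p" for A B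
      using that J'(3)[of "X - A" "X - B"] unfolding p_def by (auto simp: Diff_Int)
    show "B \<in> p" if "A \<in> p" "A \<subseteq> B \<and> B \<subseteq> X" for A B
      using that J'(4)[of "X - A" "X - B"] unfolding p_def by blast
    show "A \<in> p \<or> X - A \<in> p" if "A \<subseteq> X" for A
      using dichotomy[OF that] that unfolding p_def by (auto simp: double_diff)
  qed (use J' in \<open>auto simp: p_def\<close>)
  moreover have "p \<inter> I = {}"
  proof (rule ccontr)
    assume "p \<inter> I \<noteq> {}"
    then obtain A where "A \<subseteq> X" "X - A \<in> J" "A \<in> J" unfolding p_def using J'(1) by blast
    then have "X \<in> J" using J'(3)[of "X - A" A] by (simp add: Un_absorb2)
    then show False using J'(2) by simp
  qed
  ultimately show ?thesis by blast
qed

lemma betaN_subset_Npos: "p \<in> betaN \<Longrightarrow> A \<in> p \<Longrightarrow> A \<subseteq> Npos"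
  unfolding betaN_def ultrafilter_on_def by blast

lemma betaN_Npos: "p \<in> betaN \<Longrightarrow> Npos \<in> p"
  unfolding betaN_def ultrafilter_on_def by blast

lemma betaN_Int: "p \<in> betaN \<Longrightarrow> A \<in> p \<Longrightarrow> B \<in> p \<Longrightarrow> A \<inter> B \<in> p"
  unfolding betaN_def ultrafilter_on_def by blast

lemma betaN_mono: "p \<in> betaN \<Longrightarrow> A \<in> p \<Longrightarrow> A \<subseteq> B \<Longrightarrow> B \<subseteq> Npos \<Longrightarrow> B \<in> p"
  unfolding betaN_def ultrafilter_on_def by blast

lemma betaN_compl: "p \<in> betaN \<Longrightarrow> A \<subseteq> Npos \<Longrightarrow> A \<notin> p \<Longrightarrow> Npos - A \<in> p"
  unfolding betaN_def ultrafilter_on_def by blast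

lemma betaN_nonempty: "p \<in> betaN \<Longrightarrow> A \<in> p \<Longrightarrow> A \<noteq> {}"
  unfolding betaN_def ultrafilter_on_def by blast

lemma betaN_finite_INT:
  assumes "p \<in> betaN" "finite W" "\<And>w. w \<in> W \<Longrightarrow> C w \<in> p"
  shows "Npos \<inter> (\<Inter>w\<in>W. C w) \<in> p"
  using assms(2,3)
proof (induction W)
  case empty
  then show ?case using betaN_Npos[OF assms(1)] by simp
next
  case (insert w W)
  then have "C w \<inter> (Npos \<inter> (\<Inter>w\<in>W. C w)) \<in> p"
    using betaN_Int[OF assms(1)] by blast
  then show ?case by (simp add: Int_left_commute)
qed

lemma uf_add_betaN:
  assumes p: "p \<in> betaN" and q: "q \<in> betaN"
  shows "p \<oplus>\<^sub>\<beta> q \<in> betaN"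
proof -
  have e: "A \<in> p \<oplus>\<^sub>\<beta> q \<longleftrightarrow> A \<subseteq> Npos \<and> {x \<in> Npos. {y \<in> Npos. x + y \<in> A} \<in> q} \<in> p" for A
    unfolding uf_add_def by simp
  have "ultrafilter_on Npos (p \<oplus>\<^sub>\<beta> q)"
    unfolding ultrafilter_on_def
  proof (intro conjI ballI allI impI)
    show "p \<oplus>\<^sub>\<beta> q \<subseteq> Pow Npos" unfolding uf_add_def by blast
    have "{y \<in> Npos. x + y \<in> Npos} = Npos" for x by auto
    then show "Npos \<in> p \<oplus>\<^sub>\<beta> q" unfolding e using betaN_Npos[OF p] betaN_Npos[OF q] by simp
    show "{} \<notin> p \<oplus>\<^sub>\<beta> q" unfolding e using betaN_nonempty[OF p] betaN_nonempty[OF q] by force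
  next
    fix A B
    assume AB: "A \<in> p \<oplus>\<^sub>\<beta> q" "B \<in> p \<oplus>\<^sub>\<beta> q"
    let ?R = "\<lambda>A. {x \<in> Npos. {y \<in> Npos. x + y \<in> A} \<in> q}"
    have "?R A \<inter> ?R B \<in> p" using AB betaN_Int[OF p] unfolding e by blast
    moreover have "?R A \<inter> ?R B \<subseteq> ?R (A \<inter> B)"
    proof
      fix x
      assume "x \<in> ?R A \<inter> ?R B"
      then have "1 \<le> x" "{y \<in> Npos. x + y \<in> A} \<inter> {y \<in> Npos. x + y \<in> B} \<in> q"
        using betaN_Int[OF q] by auto
      then show "x \<in> ?R (A \<inter> B)"
        using betaN_mono[OF q] by (auto elim!: back_subst[of "\<lambda>S. S \<in> q"])
    qed
    ultimately have "?R (A \<inter> B) \<in> p" using betaN_mono[OF p, of _ "?R (A \<inter> B)"] by blast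
    then show "A \<inter> B \<in> p \<oplus>\<^sub>\<beta> q" using AB unfolding e by blast
  next
    fix A B
    assume A: "A \<in> p \<oplus>\<^sub>\<beta> q" and B: "A \<subseteq> B \<and> B \<subseteq> Npos"
    have "{y \<in> Npos. x + y \<in> A} \<in> q \<Longrightarrow> {y \<in> Npos. x + y \<in> B} \<in> q" for x
      using betaN_mono[OF q, of "{y \<in> Npos. x + y \<in> A}" "{y \<in> Npos. x + y \<in> B}"] B by blast
    then have sub: "{x \<in> Npos. {y \<in> Npos. x + y \<in> A} \<in> q}
        \<subseteq> {x \<in> Npos. {y \<in> Npos. x + y \<in> B} \<in> q}" by blast
    have "{x \<in> Npos. {y \<in> Npos. x + y \<in> A} \<in> q} \<in> p" using A unfolding e by blast
    from betaN_mono[OF p this sub] have "{x \<in> Npos. {y \<in> Npos. x + y \<in> B} \<in> q} \<in> p" by blast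
    then show "B \<in> p \<oplus>\<^sub>\<beta> q" using B unfolding e by blast
  next
    fix A
    assume A: "A \<subseteq> Npos"
    let ?R = "\<lambda>A. {x \<in> Npos. {y \<in> Npos. x + y \<in> A} \<in> q}"
    show "A \<in> p \<oplus>\<^sub>\<beta> q \<or> Npos - A \<in> p \<oplus>\<^sub>\<beta> q"
    proof (rule disjCI)
      assume "Npos - A \<notin> p \<oplus>\<^sub>\<beta> q"
      then have "?R (Npos - A) \<notin> p" unfolding e by blast
      then have *: "Npos - ?R (Npos - A) \<in> p" by (intro betaN_compl[OF p]) auto
      have "Npos - ?R (Npos - A) \<subseteq> ?R A"
      proof
        fix x
        assume x: "x \<in> Npos - ?R (Npos - A)"
        have "Npos - {y \<in> Npos. x + y \<in> A} = {y \<in> Npos. x + y \<in> Npos - A}" by auto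
        then show "x \<in> ?R A" using x betaN_compl[OF q, of "{y \<in> Npos. x + y \<in> A}"] by auto
      qed
      from betaN_mono[OF p * this] have "?R A \<in> p" by auto
      then show "A \<in> p \<oplus>\<^sub>\<beta> q" using A unfolding e by blast
    qed
  qed
  then show ?thesis unfolding betaN_def by simp
qed

lemma Jp_ufs_absorbs_left:
  assumes p: "p \<in> betaN" and q: "q \<in> Jp_ufs"
  shows "p \<oplus>\<^sub>\<beta> q \<in> Jp_ufs"
proof -
  have q': "q \<in> betaN" "\<And>A. A \<in> q \<Longrightarrow> Jp_set A" using q unfolding Jp_ufs_def by auto
  have "Jp_set A" if A: "A \<in> p \<oplus>\<^sub>\<beta> q" for A
  proof -
    have "A \<subseteq> Npos" "{x \<in> Npos. {y \<in> Npos. x + y \<in> A} \<in> q} \<in> p"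
      using A unfolding uf_add_def by auto
    then obtain x where x: "1 \<le> x" "{y \<in> Npos. x + y \<in> A} \<in> q"
      using betaN_nonempty[OF p] by fastforce
    show ?thesis unfolding Jp_set_def
    proof (intro conjI ballI)
      fix F H
      assume "F \<in> Pf int_polys0" "H \<in> Pf Npos_funs"
      with q'(2)[OF x(2)] obtain a \<beta> where a: "a \<in> Npos" "\<beta> \<in> Pf Npos"
        "\<forall>P\<in>F. \<forall>f\<in>H. int a + poly P (int (\<Sum>t\<in>\<beta>. f t)) \<in> int ` {y \<in> Npos. x + y \<in> A}"
        unfolding Jp_set_def by blast
      have "int (x + a) + poly P (int (\<Sum>t\<in>\<beta>. f t)) \<in> int ` A" if Pf: "P \<in> F" "f \<in> H" for P f
      proof -
        obtain y where "int a + poly P (int (\<Sum>t\<in>\<beta>. f t)) = int y" "x + y \<in> A"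
          using a(3) Pf by fastforce
        then show ?thesis by (intro image_eqI[of _ _ "x + y"]) auto
      qed
      then show "\<exists>a\<in>Npos. \<exists>\<beta>\<in>Pf Npos. \<forall>P\<in>F. \<forall>f\<in>H.
          int a + poly P (int (\<Sum>t\<in>\<beta>. f t)) \<in> int ` A"
        using a(1,2) by (intro bexI[of _ "x + a"] bexI[of _ \<beta>]) auto
    qed fact
  qed
  then show ?thesis using uf_add_betaN[OF p q'(1)] unfolding Jp_ufs_def by blast
qed

lemma Jp_ufs_absorbs_right:
  assumes p: "p \<in> betaN" and q: "q \<in> Jp_ufs"
  shows "q \<oplus>\<^sub>\<beta> p \<in> Jp_ufs"
proof -
  have q': "q \<in> betaN" "\<And>A. A \<in> q \<Longrightarrow> Jp_set A" using q unfolding Jp_ufs_def by auto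
  have "Jp_set A" if A: "A \<in> q \<oplus>\<^sub>\<beta> p" for A
  proof -
    let ?B = "{x \<in> Npos. {y \<in> Npos. x + y \<in> A} \<in> p}"
    have B: "A \<subseteq> Npos" "?B \<in> q" using A unfolding uf_add_def by auto
    show ?thesis unfolding Jp_set_def
    proof (intro conjI ballI)
      fix F H
      assume FH: "F \<in> Pf int_polys0" "H \<in> Pf Npos_funs"
      with q'(2)[OF B(2)] obtain a \<beta> where a: "a \<in> Npos" "\<beta> \<in> Pf Npos"
        "\<forall>P\<in>F. \<forall>f\<in>H. int a + poly P (int (\<Sum>t\<in>\<beta>. f t)) \<in> int ` ?B"
        unfolding Jp_set_def by blast
      have "finite (F \<times> H)" using FH unfolding Pf_def by auto
      moreover have "{y \<in> Npos. int a + poly P (int (\<Sum>t\<in>\<beta>. f t)) + int y \<in> int ` A} \<in> p"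
        if Pf: "P \<in> F" "f \<in> H" for P f
      proof -
        obtain x where x: "int a + poly P (int (\<Sum>t\<in>\<beta>. f t)) = int x" "{y \<in> Npos. x + y \<in> A} \<in> p"
          using a(3) Pf by fastforce
        have "int x + int y \<in> int ` A \<longleftrightarrow> x + y \<in> A" for y
          using of_nat_eq_iff[where 'a = int] by (force simp flip: of_nat_add)
        then show ?thesis unfolding x(1) using x(2) by simp
      qed
      ultimately have "Npos \<inter> (\<Inter>(P, f)\<in>F \<times> H.
          {y \<in> Npos. int a + poly P (int (\<Sum>t\<in>\<beta>. f t)) + int y \<in> int ` A}) \<in> p"
        by (intro betaN_finite_INT[OF p]) auto
      from betaN_nonempty[OF p this] obtain y where y: "y \<ge> 1"
        "\<And>P f. P \<in> F \<Longrightarrow> f \<in> H \<Longrightarrow> int a + poly P (int (\<Sum>t\<in>\<beta>. f t)) + int y \<in> int ` A"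
        by auto
      have "int (a + y) + poly P (int (\<Sum>t\<in>\<beta>. f t)) \<in> int ` A" if "P \<in> F" "f \<in> H" for P f
        using y(2)[OF that] by (simp add: add_ac)
      then show "\<exists>a\<in>Npos. \<exists>\<beta>\<in>Pf Npos. \<forall>P\<in>F. \<forall>f\<in>H.
          int a + poly P (int (\<Sum>t\<in>\<beta>. f t)) \<in> int ` A"
        using a(1,2) by (intro bexI[of _ "a + y"] bexI[of _ \<beta>]) auto
    qed fact
  qed
  then show ?thesis using uf_add_betaN[OF q'(1) p] unfolding Jp_ufs_def by blast
qed

lemma K_betaN_subset_Jp_ufs:
  assumes "Jp_ufs \<noteq> {}"
  shows "K_betaN \<subseteq> Jp_ufs"
proof -
  have "two_sided_ideal Jp_ufs"
    unfolding two_sided_ideal_def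
  proof (intro conjI ballI)
    show "Jp_ufs \<subseteq> betaN" unfolding Jp_ufs_def by (rule Collect_restrict)
  qed (simp_all only: assms Jp_ufs_absorbs_left Jp_ufs_absorbs_right not_False_eq_True)
  then show ?thesis unfolding K_betaN_def by blast
qed

lemma Jp_set_after:
  assumes A: "Jp_set A" and F: "F \<in> Pf int_polys0" and H: "H \<in> Pf Npos_funs"
  shows "\<exists>a\<in>Npos. \<exists>\<beta>\<in>Pf Npos. N < Min \<beta> \<and>
    (\<forall>P\<in>F. \<forall>f\<in>H. int a + poly P (int (\<Sum>t\<in>\<beta>. f t)) \<in> int ` A)"
proof -
  define sh :: "(nat \<Rightarrow> nat) \<Rightarrow> nat \<Rightarrow> nat" where "sh f = (\<lambda>t\<in>Npos. f (t + N))" for f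
  have "sh ` H \<in> Pf Npos_funs"
    using H unfolding Pf_def sh_def by (fastforce simp: PiE_iff)
  with A F obtain a \<gamma> where a: "a \<in> Npos" and \<gamma>: "\<gamma> \<in> Pf Npos"
    and *: "\<forall>P\<in>F. \<forall>f\<in>sh ` H. int a + poly P (int (\<Sum>t\<in>\<gamma>. f t)) \<in> int ` A"
    unfolding Jp_set_def by blast
  define \<beta> where "\<beta> = (\<lambda>t. t + N) ` \<gamma>"
  have \<gamma>': "finite \<gamma>" "\<gamma> \<noteq> {}" "\<gamma> \<subseteq> Npos" using \<gamma> unfolding Pf_def by auto
  have "(\<Sum>t\<in>\<beta>. f t) = (\<Sum>t\<in>\<gamma>. sh f t)" for f
    unfolding \<beta>_def sh_def using \<gamma>' by (subst sum.reindex) (auto intro!: sum.cong)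
  moreover have \<beta>: "\<beta> \<in> Pf Npos"
    using \<gamma>' unfolding \<beta>_def Pf_def by fastforce
  moreover have "Min \<beta> \<in> \<beta>" using \<beta> by (intro Min_in) (auto simp: Pf_def)
  then have "N < Min \<beta>" using \<gamma>' unfolding \<beta>_def by fastforce
  ultimately show ?thesis using a * by (intro bexI[of _ a] bexI[of _ \<beta>]) auto
qed

subsection \<open>Recursive construction along chains\<close>

definition star :: "nat set set \<Rightarrow> nat set \<Rightarrow> nat set" where
  "star p A = {x \<in> A. {y \<in> Npos. x + y \<in> A} \<in> p}"

lemma star_mem:
  assumes p: "idempotent_uf p" and A: "A \<in> p"
  shows "star p A \<in> p"
proof -
  have b: "p \<in> betaN" and "A \<in> p \<oplus>\<^sub>\<beta> p" using p A unfolding idempotent_uf_def by auto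
  then have "A \<inter> {x \<in> Npos. {y \<in> Npos. x + y \<in> A} \<in> p} \<in> p"
    using betaN_Int[OF b A] unfolding uf_add_def by blast
  moreover have "A \<inter> {x \<in> Npos. {y \<in> Npos. x + y \<in> A} \<in> p} = star p A"
    using betaN_subset_Npos[OF b A] unfolding star_def by blast
  ultimately show ?thesis by simp
qed

lemma star_translate:
  assumes p: "idempotent_uf p" and x: "x \<in> star p A"
  shows "{y \<in> Npos. x + y \<in> star p A} \<in> p"
proof -
  have "star p {y \<in> Npos. x + y \<in> A} \<in> p"
    using star_mem[OF p] x unfolding star_def by blast
  moreover have "{z \<in> Npos. y + z \<in> {y \<in> Npos. x + y \<in> A}} = {z \<in> Npos. (x + y) + z \<in> A}" for y
    by (auto simp: add_ac)
  then have "star p {y \<in> Npos. x + y \<in> A} = {y \<in> Npos. x + y \<in> star p A}"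
    unfolding star_def by auto
  ultimately show ?thesis by simp
qed

text \<open>
  \<open>L\<close> holds for the tuples that are \<open>p\<close>-almost surely extended step by step to a member of \<open>A\<close>.
\<close>

lemma tensor_tree:
  assumes "m \<ge> 1" and "A \<in> tensor (\<lambda>_. p) m"
  shows "\<exists>L. L [] \<and> (\<forall>xs. L xs \<and> length xs < m \<longrightarrow> {x \<in> Npos. L (xs @ [x])} \<in> p) \<and>
    (\<forall>xs. L xs \<and> length xs = m \<longrightarrow> xs \<in> A)"
  using assms
proof (induction m arbitrary: A rule: dec_induct)
  case base
  define L where "L xs \<longleftrightarrow> xs = [] \<or> xs \<in> A" for xs
  have "{x \<in> Npos. L ([] @ [x])} \<in> p" using base unfolding L_def by simp
  then show ?case by (intro exI[of _ L]) (auto simp: L_def)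
next
  case (step n)
  define A' where "A' = {xs \<in> Npos_tuples n. {x \<in> Npos. xs @ [x] \<in> A} \<in> p}"
  have "A' \<in> tensor (\<lambda>_. p) n"
    using step.prems step.hyps unfolding A'_def by (cases n) auto
  from step.IH[OF this] obtain L where L: "L []"
    "\<And>xs. L xs \<Longrightarrow> length xs < n \<Longrightarrow> {x \<in> Npos. L (xs @ [x])} \<in> p"
    "\<And>xs. L xs \<Longrightarrow> length xs = n \<Longrightarrow> xs \<in> A'" by blast
  define L' where "L' xs \<longleftrightarrow> (if length xs \<le> n then L xs else xs \<in> A)" for xs
  have "{x \<in> Npos. L' (xs @ [x])} \<in> p" if "L' xs" "length xs < Suc n" for xs
  proof (cases "length xs < n")
    case True
    then show ?thesis using L(2) that unfolding L'_def by simp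
  next
    case False
    then have "length xs = n" using that by simp
    then show ?thesis using L(3)[of xs] that unfolding L'_def A'_def by simp
  qed
  then show ?case using L(1) by (intro exI[of _ L']) (auto simp: L'_def)
qed

lemma Jp_set_partition_regular:
  assumes \<U>: "finite \<U>" "\<And>U. U \<in> \<U> \<Longrightarrow> U \<subseteq> Npos" "Npos \<subseteq> \<Union>\<U>"
  shows "\<exists>U\<in>\<U>. Jp_set U"
proof (rule ccontr)
  assume "\<not> (\<exists>U\<in>\<U>. Jp_set U)"
  then have "\<forall>U\<in>\<U>. \<exists>F H. F \<in> Pf int_polys0 \<and> H \<in> Pf Npos_funs \<and>
      (\<forall>a\<in>Npos. \<forall>\<beta>\<in>Pf Npos. \<exists>P\<in>F. \<exists>f\<in>H. int a + poly P (int (\<Sum>t\<in>\<beta>. f t)) \<notin> int ` U)"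
    using \<U>(2) unfolding Jp_set_def by meson
  then obtain F H where F: "\<And>U. U \<in> \<U> \<Longrightarrow> F U \<in> Pf int_polys0"
    and H: "\<And>U. U \<in> \<U> \<Longrightarrow> H U \<in> Pf Npos_funs"
    and bad: "\<And>U a \<beta>. U \<in> \<U> \<Longrightarrow> a \<in> Npos \<Longrightarrow> \<beta> \<in> Pf Npos \<Longrightarrow>
      \<exists>P\<in>F U. \<exists>f\<in>H U. int a + poly P (int (\<Sum>t\<in>\<beta>. f t)) \<notin> int ` U"
    by metis
  define g where "g P f M = poly P (int (sum_mset (image_mset f M)))"
    for P :: "int poly" and f :: "nat \<Rightarrow> nat" and M
  define A where "A = (\<lambda>(P, f). g P f) ` ((\<Union>U\<in>\<U>. F U) \<times> (\<Union>U\<in>\<U>. H U))"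
  have "finite A"
    unfolding A_def using \<U>(1) F H by (auto simp: Pf_def)
  have "IP_vdw A"
  proof (rule IP_vdw_poly_map[OF \<open>finite A\<close>])
    fix k
    assume "k \<in> A"
    then obtain U P f where "U \<in> \<U>" "P \<in> F U" and k: "k = g P f" unfolding A_def by auto
    then have "poly P 0 = 0" using F[of U] unfolding Pf_def int_polys0_def
      by (auto simp: poly_0_coeff_0)
    moreover have "\<exists>d. poly_map d (\<lambda>M. poly P (int (sum_mset (image_mset f M))))"
      by (rule poly_map_poly) simp
    ultimately show "k 0 = 0 \<and> (\<exists>d. poly_map d k)"
      unfolding k g_def by simp
  qed
  \<comment> \<open>Multisets are the free commutative monoid, so one sequence serves all \<open>f\<close> simultaneously.\<close>
  define s :: "nat \<Rightarrow> nat multiset" where "s t = {#Suc t#}" for t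
  have g_s: "g P f (sum s \<beta>) = poly P (int (\<Sum>t\<in>Suc ` \<beta>. f t))" if "finite \<beta>" for P f \<beta>
  proof -
    have "sum_mset (image_mset f (sum s \<beta>)) = (\<Sum>t\<in>\<beta>. f (Suc t))"
      using that by (induction \<beta>) (auto simp: s_def)
    then show ?thesis unfolding g_def by (simp add: sum.reindex)
  qed
  obtain e :: "nat set \<Rightarrow> nat" and r where e: "e ` \<U> = {i. i < r}" "inj_on e \<U>"
    using finite_imp_inj_to_nat_seg[OF \<U>(1)] by blast
  obtain M where M: "\<And>c :: int \<Rightarrow> nat. (\<forall>x. c x < r) \<Longrightarrow>
     (\<exists>a \<beta>. \<bar>a\<bar> \<le> int M \<and> \<beta> \<noteq> {} \<and> \<beta> \<subseteq> {..<M} \<and> (\<forall>k\<in>A. c (a + k (sum s \<beta>)) = c a))"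
    using \<open>IP_vdw A\<close>[unfolded IP_vdw_def, THEN spec, of r, THEN spec, of s] by blast
  have "finite ((\<lambda>(k, \<beta>). k (sum s \<beta>)) ` (A \<times> Pow {..<M}))" using \<open>finite A\<close> by auto
  from finite_int_bound[OF this] obtain K where
    K: "\<And>x. x \<in> (\<lambda>(k, \<beta>). k (sum s \<beta>)) ` (A \<times> Pow {..<M}) \<Longrightarrow> \<bar>x\<bar> \<le> int K"
    by metis
  have "\<exists>U\<in>\<U>. n \<in> U" if "1 \<le> n" for n using that \<U>(3) by auto
  then obtain cell where cell: "\<And>n. 1 \<le> n \<Longrightarrow> cell n \<in> \<U>" "\<And>n. 1 \<le> n \<Longrightarrow> n \<in> cell n"
    by metis
  define pos where "pos x = nat (max 1 (x + int (M + K + 1)))" for x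
  have "e (cell (pos x)) < r" for x
    using e(1) cell(1)[of "pos x"] unfolding pos_def by auto
  then have "\<forall>x. e (cell (pos x)) < r" by blast
  from M[OF this] obtain a \<beta> where a: "\<bar>a\<bar> \<le> int M" and \<beta>: "\<beta> \<noteq> {}" "\<beta> \<subseteq> {..<M}"
    and same: "\<And>k. k \<in> A \<Longrightarrow> e (cell (pos (a + k (sum s \<beta>)))) = e (cell (pos a))"
    by auto
  have fin: "finite \<beta>" using \<beta>(2) finite_subset by blast
  have pos_a: "1 \<le> pos a" "int (pos a) = a + int (M + K + 1)"
    using a unfolding pos_def by auto
  have "Suc ` \<beta> \<in> Pf Npos" using fin \<beta>(1) unfolding Pf_def by auto
  with bad[OF cell(1)[OF pos_a(1)], of "pos a" "Suc ` \<beta>"] obtain P f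
    where Pf: "P \<in> F (cell (pos a))" "f \<in> H (cell (pos a))"
    and out: "int (pos a) + poly P (int (\<Sum>t\<in>Suc ` \<beta>. f t)) \<notin> int ` cell (pos a)"
    using pos_a(1) by blast
  have gA: "g P f \<in> A" unfolding A_def using Pf cell(1)[OF pos_a(1)] by force
  have "\<bar>g P f (sum s \<beta>)\<bar> \<le> int K"
    using gA \<beta>(2) by (intro K image_eqI[of _ _ "(g P f, \<beta>)"]) auto
  then have pos_b: "1 \<le> pos (a + g P f (sum s \<beta>))"
    "int (pos (a + g P f (sum s \<beta>))) = int (pos a) + g P f (sum s \<beta>)"
    using a unfolding pos_def by auto
  have "cell (pos (a + g P f (sum s \<beta>))) = cell (pos a)"
    using same[OF gA] e(2) cell(1)[OF pos_a(1)] cell(1)[OF pos_b(1)] by (auto dest: inj_onD)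
  then have "int (pos a) + g P f (sum s \<beta>) \<in> int ` cell (pos a)"
    using cell(2)[OF pos_b(1)] pos_b(2)
    by (intro image_eqI[of _ _ "pos (a + g P f (sum s \<beta>))"]) simp_all
  then show False using out unfolding g_s[OF fin] by simp
qed

lemma Jp_ufs_nonempty: "Jp_ufs \<noteq> {}"
proof -
  define I where "I = {A. \<exists>\<U>. finite \<U> \<and> (\<forall>U\<in>\<U>. U \<subseteq> Npos \<and> \<not> Jp_set U) \<and> A \<subseteq> \<Union>\<U>}"
  have "\<exists>q. ultrafilter_on Npos q \<and> q \<inter> I = {}"
  proof (rule ultrafilter_avoiding_ideal)
    show "Npos \<notin> I" unfolding I_def using Jp_set_partition_regular by blast
    show "{} \<in> I" unfolding I_def by (auto intro: exI[of _ "{}"])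
    show "A \<union> B \<in> I" if "A \<in> I" "B \<in> I" for A B
    proof -
      obtain \<U> \<V> where "finite \<U>" "\<forall>U\<in>\<U>. U \<subseteq> Npos \<and> \<not> Jp_set U" "A \<subseteq> \<Union>\<U>"
        "finite \<V>" "\<forall>U\<in>\<V>. U \<subseteq> Npos \<and> \<not> Jp_set U" "B \<subseteq> \<Union>\<V>"
        using \<open>A \<in> I\<close> \<open>B \<in> I\<close> unfolding I_def by blast
      then show ?thesis unfolding I_def by (intro CollectI exI[of _ "\<U> \<union> \<V>"]) auto
    qed
    show "B \<in> I" if "A \<in> I" "B \<subseteq> A" for A B
    proof -
      obtain \<U> where "finite \<U>" "\<forall>U\<in>\<U>. U \<subseteq> Npos \<and> \<not> Jp_set U" "A \<subseteq> \<Union>\<U>"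
        using \<open>A \<in> I\<close> unfolding I_def by blast
      then show ?thesis unfolding I_def
        using \<open>B \<subseteq> A\<close> by (intro CollectI exI[of _ \<U>]) auto
    qed
  qed
  then obtain q where q: "ultrafilter_on Npos q" "q \<inter> I = {}" by blast
  have "A \<in> I" if "A \<subseteq> Npos" "\<not> Jp_set A" for A
    unfolding I_def using that by (intro CollectI exI[of _ "{A}"]) auto
  moreover have "q \<in> betaN" unfolding betaN_def using q(1) by simp
  ultimately have "q \<in> Jp_ufs"
    using q(2) betaN_subset_Npos[of q] unfolding Jp_ufs_def by blast
  then show ?thesis by blast
qed

text \<open>
  \<open>E G\<close> collects the states reached after processing chains whose last member is contained in
  \<open>G\<close>. It is chosen together with \<open>\<alpha> G\<close> and \<open>H G\<close>, so that its finiteness is available in the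
  recursion.
\<close>

lemma adapted_recursion:
  fixes step :: "'s \<Rightarrow> nat \<Rightarrow> nat \<Rightarrow> 's set" and I W0 :: "'s set"
  assumes fin: "\<And>w a \<sigma>. finite (step w a \<sigma>)"
    and ext: "\<And>W F N. finite W \<Longrightarrow> W \<subseteq> I \<Longrightarrow> F \<in> Pf Npos_funs \<Longrightarrow>
      \<exists>a\<in>Npos. \<exists>\<beta>\<in>Pf Npos. N < Min \<beta> \<and> (\<forall>w\<in>W. \<forall>f\<in>F. step w a (\<Sum>t\<in>\<beta>. f t) \<subseteq> I)"
    and W0: "finite W0" "W0 \<subseteq> I"
  obtains \<alpha> H E where "\<alpha> \<in> Pf Npos_funs \<rightarrow> Npos" "H \<in> Pf Npos_funs \<rightarrow> Pf Npos"
    and "\<And>G. G \<in> Pf Npos_funs \<Longrightarrow> E G \<subseteq> I"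
    and "\<And>G f w. G \<in> Pf Npos_funs \<Longrightarrow> f \<in> G \<Longrightarrow> w \<in> W0 \<Longrightarrow>
      insert w (step w (\<alpha> G) (\<Sum>t\<in>H G. f t)) \<subseteq> E G"
    and "\<And>G K f w. G \<in> Pf Npos_funs \<Longrightarrow> K \<in> Pf Npos_funs \<Longrightarrow> G \<subset> K \<Longrightarrow> f \<in> K \<Longrightarrow> w \<in> E G \<Longrightarrow>
      insert w (step w (\<alpha> K) (\<Sum>t\<in>H K. f t)) \<subseteq> E K"
    and "\<And>G K. G \<in> Pf Npos_funs \<Longrightarrow> K \<in> Pf Npos_funs \<Longrightarrow> G \<subset> K \<Longrightarrow> H G \<lless> H K"
proof -
  define below :: "(nat \<Rightarrow> nat) set \<Rightarrow> _" where "below G = {F \<in> Pf Npos_funs. F \<subset> G}" for G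
  define pre where "pre \<phi> G = W0 \<union> (\<Union>F\<in>below G. snd (snd (\<phi> F)))"
    for \<phi> :: "(nat \<Rightarrow> nat) set \<Rightarrow> nat \<times> nat set \<times> 's set" and G
  define Q where "Q \<phi> G r \<longleftrightarrow> (G \<in> Pf Npos_funs \<longrightarrow> (case r of (a, h, E) \<Rightarrow>
      a \<in> Npos \<and> h \<in> Pf Npos \<and> finite E \<and> E \<subseteq> I \<and> pre \<phi> G \<subseteq> E \<and>
      (\<forall>F\<in>below G. fst (snd (\<phi> F)) \<lless> h) \<and>
      (\<forall>w\<in>pre \<phi> G. \<forall>f\<in>G. step w a (\<Sum>t\<in>h. f t) \<subseteq> E)))" for \<phi> G r
  have "\<exists>\<phi>. \<forall>G. Q \<phi> G (\<phi> G)"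
  proof (rule dependent_wf_choice[OF wf_finite_psubset])
    fix \<phi> \<psi> :: "(nat \<Rightarrow> nat) set \<Rightarrow> nat \<times> nat set \<times> 's set" and G r
    assume eq: "\<And>F. (F, G) \<in> finite_psubset \<Longrightarrow> \<phi> F = \<psi> F"
    show "Q \<phi> G r = Q \<psi> G r"
    proof (cases "G \<in> Pf Npos_funs")
      case True
      then have "\<phi> F = \<psi> F" if "F \<in> below G" for F
        using eq that unfolding below_def Pf_def finite_psubset_def by auto
      then show ?thesis unfolding Q_def pre_def by simp
    qed (auto simp: Q_def)
  next
    fix G and \<phi> :: "(nat \<Rightarrow> nat) set \<Rightarrow> nat \<times> nat set \<times> 's set"
    assume IH: "\<And>F. (F, G) \<in> finite_psubset \<Longrightarrow> Q \<phi> F (\<phi> F)"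
    show "\<exists>r. Q \<phi> G r"
    proof (cases "G \<in> Pf Npos_funs")
      case True
      then have G: "finite G" unfolding Pf_def by auto
      have QF: "Q \<phi> F (\<phi> F)" "F \<in> Pf Npos_funs" if "F \<in> below G" for F
        using IH that G unfolding below_def finite_psubset_def by auto
      have snd2: "finite (snd (snd (\<phi> F)))" "snd (snd (\<phi> F)) \<subseteq> I" if "F \<in> below G" for F
        using QF[OF that] unfolding Q_def by (auto split: prod.splits)
      have "finite (below G)"
        by (rule finite_subset[of _ "Pow G"]) (use G in \<open>auto simp: below_def\<close>)
      then have pre: "finite (pre \<phi> G)" "pre \<phi> G \<subseteq> I"
        using snd2 W0 unfolding pre_def by auto
      define N where "N = Max (insert 0 ((\<lambda>F. Max (fst (snd (\<phi> F)))) ` below G))"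
      have N: "Max (fst (snd (\<phi> F))) \<le> N" if "F \<in> below G" for F
        unfolding N_def using \<open>finite (below G)\<close> that by (intro Max_ge) auto
      obtain a \<beta> where a: "a \<in> Npos" "\<beta> \<in> Pf Npos" "N < Min \<beta>"
        "\<forall>w\<in>pre \<phi> G. \<forall>f\<in>G. step w a (\<Sum>t\<in>\<beta>. f t) \<subseteq> I"
        using ext[OF pre True, of N] by blast
      define E where "E = pre \<phi> G \<union> (\<Union>w\<in>pre \<phi> G. \<Union>f\<in>G. step w a (\<Sum>t\<in>\<beta>. f t))"
      have "finite E" unfolding E_def using pre G fin by auto
      moreover have "E \<subseteq> I" unfolding E_def using pre(2) a(4) by blast
      moreover have "\<forall>F\<in>below G. fst (snd (\<phi> F)) \<lless> \<beta>"
        using N a(3) unfolding set_before_def by fastforce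
      moreover have "pre \<phi> G \<subseteq> E" "\<forall>w\<in>pre \<phi> G. \<forall>f\<in>G. step w a (\<Sum>t\<in>\<beta>. f t) \<subseteq> E"
        unfolding E_def by blast+
      ultimately have "Q \<phi> G (a, \<beta>, E)" using a(1,2) unfolding Q_def by auto
      then show ?thesis by blast
    qed (auto simp: Q_def)
  qed
  then obtain \<phi> where \<phi>: "\<And>G. Q \<phi> G (\<phi> G)" by blast
  define \<alpha> where "\<alpha> G = fst (\<phi> G)" for G
  define H where "H G = fst (snd (\<phi> G))" for G
  define E where "E G = snd (snd (\<phi> G))" for G
  have main: "\<alpha> G \<in> Npos" "H G \<in> Pf Npos" "E G \<subseteq> I" "pre \<phi> G \<subseteq> E G"
      "\<forall>F\<in>below G. H F \<lless> H G"
      "\<forall>w\<in>pre \<phi> G. \<forall>f\<in>G. step w (\<alpha> G) (\<Sum>t\<in>H G. f t) \<subseteq> E G"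
    if "G \<in> Pf Npos_funs" for G
    using \<phi>[of G] that unfolding Q_def \<alpha>_def H_def E_def by (auto simp: case_prod_unfold)
  have pre: "w \<in> pre \<phi> G" if "w \<in> W0" for w G using that unfolding pre_def by simp
  have pre': "w \<in> pre \<phi> K" if "G \<in> Pf Npos_funs" "G \<subset> K" "w \<in> E G" for w G K
    using that unfolding pre_def below_def E_def by blast
  show thesis
  proof (rule that[of \<alpha> H E])
    show "insert w (step w (\<alpha> G) (\<Sum>t\<in>H G. f t)) \<subseteq> E G"
      if "G \<in> Pf Npos_funs" "f \<in> G" "w \<in> W0" for G f w
      using main(4,6)[OF that(1)] pre[OF that(3)] that(2) by blast
    show "insert w (step w (\<alpha> K) (\<Sum>t\<in>H K. f t)) \<subseteq> E K"
      if "G \<in> Pf Npos_funs" "K \<in> Pf Npos_funs" "G \<subset> K" "f \<in> K" "w \<in> E G" for G K f w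
      using main(4,6)[OF that(2)] pre'[OF that(1,3,5)] that(4) by blast
    show "H G \<lless> H K" if "G \<in> Pf Npos_funs" "K \<in> Pf Npos_funs" "G \<subset> K" for G K
      using main(5)[OF that(2)] that unfolding below_def by blast
  qed (use main in auto)
qed

text \<open>
  A state \<open>(xs, u, s, P)\<close> consists of the values \<open>xs\<close> of the completed blocks, the partial sums
  \<open>u\<close> of \<open>\<alpha>\<close> and \<open>s\<close> of the function values over the current block, and the polynomial \<open>P\<close> reserved
  for this block. A step adds an index to the current block and possibly closes the block, in which
  case the polynomial of the next one is guessed.
\<close>

definition block_step ::
  "int poly set \<Rightarrow> int list \<times> nat \<times> nat \<times> int poly \<Rightarrow> nat \<Rightarrow> nat \<Rightarrow>
    (int list \<times> nat \<times> nat \<times> int poly) set" where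
  "block_step T w a \<sigma> = (case w of (xs, u, s, P) \<Rightarrow>
     insert (xs, u + a, s + \<sigma>, P)
       ((\<lambda>Q. (xs @ [int (u + a) + poly P (int (s + \<sigma>))], 0, 0, Q)) ` T))"

definition block_inv ::
  "nat set set \<Rightarrow> nat \<Rightarrow> (nat list \<Rightarrow> bool) \<Rightarrow> int poly set \<Rightarrow>
    (int list \<times> nat \<times> nat \<times> int poly) set" where
  "block_inv p m L T = {(xs, u, s, P). P \<in> T \<and> (length xs \<le> m \<longrightarrow>
     (\<exists>ys. xs = map int ys \<and> L ys \<and> (length ys < m \<longrightarrow> u = 0 \<and> s = 0 \<or>
        int u + poly P (int s) \<in> int ` star p {x \<in> Npos. L (ys @ [x])})))}"

lemma block_inv_extend:
  assumes p: "idempotent_uf p" "p \<in> Jp_ufs" and T: "T \<in> Pf int_polys0"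
    and L: "\<And>xs. L xs \<Longrightarrow> length xs < m \<Longrightarrow> {x \<in> Npos. L (xs @ [x])} \<in> p"
    and W: "finite W" "W \<subseteq> block_inv p m L T" and F: "F \<in> Pf Npos_funs"
  shows "\<exists>a\<in>Npos. \<exists>\<beta>\<in>Pf Npos. N < Min \<beta> \<and>
    (\<forall>w\<in>W. \<forall>f\<in>F. block_step T w a (\<Sum>t\<in>\<beta>. f t) \<subseteq> block_inv p m L T)"
proof -
  have b: "p \<in> betaN" and Jp: "\<And>A. A \<in> p \<Longrightarrow> Jp_set A" using p unfolding Jp_ufs_def by auto
  define S where "S ys = {x \<in> Npos. L (ys @ [x])}" for ys
  define ok where "ok w C \<longleftrightarrow> (case w of (xs, u, s, P) \<Rightarrow> C \<in> p \<and> (length xs < m \<longrightarrow>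
     (\<exists>ys. xs = map int ys \<and> L ys \<and>
       (\<forall>y\<in>C. int u + poly P (int s) + int y \<in> int ` star p (S ys)))))"
    for w :: "int list \<times> nat \<times> nat \<times> int poly" and C
  have "\<exists>C. ok w C" if "w \<in> W" for w
  proof -
    obtain xs u s P where w: "w = (xs, u, s, P)" by (cases w) auto
    then have inv: "(xs, u, s, P) \<in> block_inv p m L T" using W(2) that by blast
    show ?thesis
    proof (cases "length xs < m")
      case False
      then show ?thesis using betaN_Npos[OF b] unfolding ok_def w by auto
    next
      case True
      then obtain ys where ys: "xs = map int ys" "L ys"
        "u = 0 \<and> s = 0 \<or> int u + poly P (int s) \<in> int ` star p (S ys)"
        using inv unfolding block_inv_def S_def by auto
      have S: "star p (S ys) \<in> p"
        using star_mem[OF p(1) L] ys True unfolding S_def by simp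
      consider "u = 0" "s = 0" | x where "x \<in> star p (S ys)" "int u + poly P (int s) = int x"
        using ys(3) by blast
      then show ?thesis
      proof cases
        case 1
        have "poly P 0 = 0"
          using inv T unfolding block_inv_def Pf_def int_polys0_def by (auto simp: poly_0_coeff_0)
        then have "ok w (star p (S ys))" using 1 S ys unfolding ok_def w by auto
        then show ?thesis by blast
      next
        case 2
        have "int x + int y \<in> int ` star p (S ys)" if "x + y \<in> star p (S ys)" for y
          using that by (intro image_eqI[of _ _ "x + y"]) auto
        then have "ok w {y \<in> Npos. x + y \<in> star p (S ys)}"
          using 2 star_translate[OF p(1) 2(1)] ys unfolding ok_def w by auto
        then show ?thesis by blast
      qed
    qed
  qed
  then obtain C where C: "\<And>w. w \<in> W \<Longrightarrow> ok w (C w)" by metis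
  have "Npos \<inter> (\<Inter>w\<in>W. C w) \<in> p"
    using C by (intro betaN_finite_INT[OF b W(1)]) (auto simp: ok_def)
  then have Jp_B: "Jp_set (Npos \<inter> (\<Inter>w\<in>W. C w))" by (rule Jp)
  define D where "D = (\<lambda>(xs :: int list, u :: nat, s :: nat, P :: int poly).
      P \<circ>\<^sub>p [:int s, 1:] - [:poly P (int s):])"
  have poly_D: "poly (D (xs, u, s, P)) (int \<sigma>) = poly P (int (s + \<sigma>)) - poly P (int s)"
    for xs u s P \<sigma> unfolding D_def by (simp add: poly_pcompose)
  have "coeff (D w) 0 = 0" for w
    unfolding D_def by (cases w) (simp add: poly_pcompose flip: poly_0_coeff_0)
  then have "insert 0 (D ` W) \<in> Pf int_polys0" using W(1) unfolding Pf_def int_polys0_def by auto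
  from Jp_set_after[OF Jp_B this F, of N] obtain a \<beta> where a: "a \<in> Npos" "\<beta> \<in> Pf Npos" "N < Min \<beta>"
    and in_B: "\<And>w f. w \<in> W \<Longrightarrow> f \<in> F \<Longrightarrow>
      int a + poly (D w) (int (\<Sum>t\<in>\<beta>. f t)) \<in> int ` (Npos \<inter> (\<Inter>w\<in>W. C w))"
    by blast
  have "block_step T w a (\<Sum>t\<in>\<beta>. f t) \<subseteq> block_inv p m L T" if wf: "w \<in> W" "f \<in> F" for w f
  proof -
    obtain xs u s P where w: "w = (xs, u, s, P)" by (cases w) auto
    have inv: "(xs, u, s, P) \<in> block_inv p m L T" using W(2) wf w by blast
    then have P: "P \<in> T" unfolding block_inv_def by simp
    define \<sigma> where "\<sigma> = (\<Sum>t\<in>\<beta>. f t)"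
    define z where "z = int (u + a) + poly P (int (s + \<sigma>))"
    show ?thesis
    proof (cases "length xs < m")
      case False
      then have "block_step T w a \<sigma> \<subseteq> block_inv p m L T"
        using inv unfolding w block_step_def block_inv_def by auto
      then show ?thesis unfolding \<sigma>_def .
    next
      case True
      then obtain ys where ys: "xs = map int ys" "L ys"
        and C_w: "\<And>y. y \<in> C w \<Longrightarrow> int u + poly P (int s) + int y \<in> int ` star p (S ys)"
        using C[OF wf(1)] unfolding ok_def w by auto
      obtain y where y: "y \<in> C w" "int a + (poly P (int (s + \<sigma>)) - poly P (int s)) = int y"
        using in_B[OF wf] wf(1) unfolding w poly_D \<sigma>_def by blast
      have "z = int u + poly P (int s) + int y" unfolding z_def using y(2) by simp
      then have z: "z \<in> int ` star p (S ys)" using C_w[OF y(1)] by simp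
      then have "(xs, u + a, s + \<sigma>, P) \<in> block_inv p m L T"
        unfolding block_inv_def using P ys unfolding z_def S_def by auto
      moreover have "(xs @ [z], 0, 0, Q) \<in> block_inv p m L T" if "Q \<in> T" for Q
      proof -
        obtain y where "z = int y" "y \<in> S ys" using z unfolding star_def by blast
        then have "xs @ [z] = map int (ys @ [y])" "L (ys @ [y])" using ys unfolding S_def by auto
        then show ?thesis using that unfolding block_inv_def by blast
      qed
      ultimately have "block_step T w a \<sigma> \<subseteq> block_inv p m L T"
        unfolding w block_step_def z_def by auto
      then show ?thesis unfolding \<sigma>_def .
    qed
  qed
  then show ?thesis using a by blast
qed

lemma block_run:
  fixes E :: "nat \<Rightarrow> (int list \<times> nat \<times> nat \<times> int poly) set" and a \<sigma> :: "nat \<Rightarrow> nat"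
  assumes stp: "\<And>k i w. w \<in> E k \<Longrightarrow> k < i \<Longrightarrow> i \<le> n \<Longrightarrow> block_step T w (a i) (\<sigma> i) \<subseteq> E i"
    and start: "(xs, 0, 0, P) \<in> E k" and \<beta>: "finite \<beta>" "\<beta> \<noteq> {}" "\<beta> \<subseteq> {k<..n}" and Q: "Q \<in> T"
  shows "(xs @ [int (sum a \<beta>) + poly P (int (sum \<sigma> \<beta>))], 0, 0, Q) \<in> E (Max \<beta>)"
proof -
  have partial: "(xs, sum a \<gamma>, sum \<sigma> \<gamma>, P) \<in> E (Max (insert k \<gamma>))"
    if "finite \<gamma>" "\<gamma> \<subseteq> {k<..n}" for \<gamma>
    using that
  proof (induction \<gamma> rule: finite_linorder_max_induct)
    case empty
    then show ?case using start by simp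
  next
    case (insert i \<gamma>)
    have lt: "Max (insert k \<gamma>) < i" using insert by (subst Max_less_iff) auto
    then have "Max (insert k (insert i \<gamma>)) = i"
      using insert.hyps(1) by (subst insert_commute, subst Max_insert) auto
    moreover have "block_step T (xs, sum a \<gamma>, sum \<sigma> \<gamma>, P) (a i) (\<sigma> i) \<subseteq> E i"
      using insert lt by (intro stp[of _ "Max (insert k \<gamma>)"]) auto
    moreover have "i \<notin> \<gamma>" using insert.hyps(2) by blast
    ultimately show ?case using insert.hyps(1) unfolding block_step_def by (simp add: add.commute)
  qed
  define i where "i = Max \<beta>"
  define \<gamma> where "\<gamma> = \<beta> - {i}"
  have i: "i \<in> \<beta>" unfolding i_def using \<beta> by simp
  have lt: "j < i" if "j \<in> \<gamma>" for j
    using Max_ge[OF \<beta>(1), of j] that unfolding \<gamma>_def i_def by auto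
  have "Max (insert k \<gamma>) < i"
    using lt i \<beta> by (subst Max_less_iff) (auto simp: \<gamma>_def)
  moreover have "(xs, sum a \<gamma>, sum \<sigma> \<gamma>, P) \<in> E (Max (insert k \<gamma>))"
    using \<beta> unfolding \<gamma>_def by (intro partial) auto
  ultimately have "block_step T (xs, sum a \<gamma>, sum \<sigma> \<gamma>, P) (a i) (\<sigma> i) \<subseteq> E i"
    using i \<beta> by (intro stp[of _ "Max (insert k \<gamma>)"]) auto
  moreover have "sum a \<beta> = sum a \<gamma> + a i" "sum \<sigma> \<beta> = sum \<sigma> \<gamma> + \<sigma> i"
    using \<beta>(1) i unfolding \<gamma>_def by (simp_all add: sum.remove)
  ultimately show ?thesis using Q unfolding block_step_def i_def by auto
qed

theorem theorem1p27:
  fixes m :: nat and p :: "nat set set"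
  assumes "m \<ge> 1"
    and "minimal_idempotent p \<or> (idempotent_uf p \<and> p \<in> Jp_ufs)"
  shows "\<forall>A \<in> tensor (\<lambda>_. p) m. \<forall>T \<in> Pf int_polys0.
    \<exists>\<alpha> \<in> Pf Npos_funs \<rightarrow> Npos. \<exists>H \<in> Pf Npos_funs \<rightarrow> Pf Npos.
      (\<forall>G \<in> Pf Npos_funs. \<forall>K \<in> Pf Npos_funs. G \<subset> K \<longrightarrow> H G \<lless> H K) \<and>
      (\<forall>n \<ge> m. \<forall>G :: nat \<Rightarrow> (nat \<Rightarrow> nat) set.
         (\<forall>i \<in> {1..n}. G i \<in> Pf Npos_funs) \<and> (\<forall>i \<in> {1..<n}. G i \<subset> G (Suc i)) \<longrightarrow>
         (\<forall>(\<beta> :: nat \<Rightarrow> nat set) (f :: nat \<Rightarrow> nat \<Rightarrow> nat) (P :: nat \<Rightarrow> int poly).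
            (\<forall>j \<in> {1..m}. \<beta> j \<in> Pf Npos) \<and>
            (\<forall>j \<in> {1..<m}. \<beta> j \<lless> \<beta> (Suc j)) \<and>
            Max (\<beta> m) \<le> n \<and>
            (\<forall>i \<in> {1..n}. f i \<in> G i) \<and>
            (\<forall>j \<in> {1..m}. P j \<in> T) \<longrightarrow>
            map (\<lambda>j. int (\<Sum>i\<in>\<beta> j. \<alpha> (G i)) +
                     poly (P j) (int (\<Sum>i\<in>\<beta> j. \<Sum>t\<in>H (G i). f i t))) [1..<Suc m]
              \<in> map int ` A))"
proof (intro ballI)
  fix A T
  assume A: "A \<in> tensor (\<lambda>_. p) m" and T: "T \<in> Pf int_polys0"
  have p: "idempotent_uf p" "p \<in> Jp_ufs"
    using assms(2) K_betaN_subset_Jp_ufs[OF Jp_ufs_nonempty]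
    unfolding minimal_idempotent_def by auto
  obtain L where L: "L []"
    "\<And>xs. L xs \<Longrightarrow> length xs < m \<Longrightarrow> {x \<in> Npos. L (xs @ [x])} \<in> p"
    "\<And>xs. L xs \<Longrightarrow> length xs = m \<Longrightarrow> xs \<in> A"
    using tensor_tree[OF assms(1) A] by blast
  define W0 where "W0 = (\<lambda>Q :: int poly. ([] :: int list, 0 :: nat, 0 :: nat, Q)) ` T"
  have W0: "finite W0" "W0 \<subseteq> block_inv p m L T"
    using T L(1) unfolding W0_def Pf_def block_inv_def by auto
  have fin: "finite (block_step T w a \<sigma>)" for w a \<sigma>
    using T unfolding block_step_def Pf_def by (cases w) auto
  obtain \<alpha> H E where \<alpha>: "\<alpha> \<in> Pf Npos_funs \<rightarrow> Npos" and H: "H \<in> Pf Npos_funs \<rightarrow> Pf Npos"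
    and E_inv: "\<And>G. G \<in> Pf Npos_funs \<Longrightarrow> E G \<subseteq> block_inv p m L T"
    and E_init: "\<And>G f w. G \<in> Pf Npos_funs \<Longrightarrow> f \<in> G \<Longrightarrow> w \<in> W0 \<Longrightarrow>
      insert w (block_step T w (\<alpha> G) (\<Sum>t\<in>H G. f t)) \<subseteq> E G"
    and E_step: "\<And>G K f w. G \<in> Pf Npos_funs \<Longrightarrow> K \<in> Pf Npos_funs \<Longrightarrow> G \<subset> K \<Longrightarrow> f \<in> K \<Longrightarrow>
      w \<in> E G \<Longrightarrow> insert w (block_step T w (\<alpha> K) (\<Sum>t\<in>H K. f t)) \<subseteq> E K"
    and H_mono: "\<And>G K. G \<in> Pf Npos_funs \<Longrightarrow> K \<in> Pf Npos_funs \<Longrightarrow> G \<subset> K \<Longrightarrow> H G \<lless> H K"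
    by (rule adapted_recursion[OF fin block_inv_extend[OF p T L(2)] W0]) blast+
  show "\<exists>\<alpha> \<in> Pf Npos_funs \<rightarrow> Npos. \<exists>H \<in> Pf Npos_funs \<rightarrow> Pf Npos.
      (\<forall>G \<in> Pf Npos_funs. \<forall>K \<in> Pf Npos_funs. G \<subset> K \<longrightarrow> H G \<lless> H K) \<and>
      (\<forall>n \<ge> m. \<forall>G :: nat \<Rightarrow> (nat \<Rightarrow> nat) set.
         (\<forall>i \<in> {1..n}. G i \<in> Pf Npos_funs) \<and> (\<forall>i \<in> {1..<n}. G i \<subset> G (Suc i)) \<longrightarrow>
         (\<forall>(\<beta> :: nat \<Rightarrow> nat set) (f :: nat \<Rightarrow> nat \<Rightarrow> nat) (P :: nat \<Rightarrow> int poly).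
            (\<forall>j \<in> {1..m}. \<beta> j \<in> Pf Npos) \<and>
            (\<forall>j \<in> {1..<m}. \<beta> j \<lless> \<beta> (Suc j)) \<and>
            Max (\<beta> m) \<le> n \<and>
            (\<forall>i \<in> {1..n}. f i \<in> G i) \<and>
            (\<forall>j \<in> {1..m}. P j \<in> T) \<longrightarrow>
            map (\<lambda>j. int (\<Sum>i\<in>\<beta> j. \<alpha> (G i)) +
                     poly (P j) (int (\<Sum>i\<in>\<beta> j. \<Sum>t\<in>H (G i). f i t))) [1..<Suc m]
              \<in> map int ` A))"
  proof (rule bexI[OF _ \<alpha>], rule bexI[OF _ H], intro conjI ballI allI impI; (elim conjE)?)
    show "H G \<lless> H K" if "G \<in> Pf Npos_funs" "K \<in> Pf Npos_funs" "G \<subset> K" for G K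
      using H_mono that .
  next
    fix n and G :: "nat \<Rightarrow> (nat \<Rightarrow> nat) set" and \<beta> :: "nat \<Rightarrow> nat set"
      and f :: "nat \<Rightarrow> nat \<Rightarrow> nat" and P :: "nat \<Rightarrow> int poly"
    assume G: "\<forall>i \<in> {1..n}. G i \<in> Pf Npos_funs" and G_chain: "\<forall>i \<in> {1..<n}. G i \<subset> G (Suc i)"
      and \<beta>: "\<forall>j \<in> {1..m}. \<beta> j \<in> Pf Npos" and \<beta>_chain: "\<forall>j \<in> {1..<m}. \<beta> j \<lless> \<beta> (Suc j)"
      and \<beta>_n: "Max (\<beta> m) \<le> n" and f: "\<forall>i \<in> {1..n}. f i \<in> G i" and P: "\<forall>j \<in> {1..m}. P j \<in> T"
    define E' where "E' k = (if k = 0 then W0 else E (G k))" for k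
    define a where "a i = \<alpha> (G i)" for i
    define \<sigma> where "\<sigma> i = (\<Sum>t\<in>H (G i). f i t)" for i
    define v where "v j = int (sum a (\<beta> j)) + poly (P j) (int (sum \<sigma> (\<beta> j)))" for j
    have E'_Suc: "insert w (block_step T w (a (Suc k)) (\<sigma> (Suc k))) \<subseteq> E' (Suc k)"
      if "w \<in> E' k" "Suc k \<le> n" for w k
    proof (cases "k = 0")
      case True
      then show ?thesis
        using E_init[of "G (Suc k)" "f (Suc k)" w] that G f unfolding E'_def a_def \<sigma>_def by simp
    next
      case False
      then show ?thesis
        using E_step[of "G k" "G (Suc k)" "f (Suc k)" w] that G f G_chain
        unfolding E'_def a_def \<sigma>_def by simp
    qed
    have E'_mono: "E' k \<subseteq> E' l" if "k \<le> l" "l \<le> n" for k l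
      using that by (induction l rule: dec_induct) (use E'_Suc in fastforce)+
    have stp: "block_step T w (a i) (\<sigma> i) \<subseteq> E' i" if "w \<in> E' k" "k < i" "i \<le> n" for w k i
    proof (cases i)
      case (Suc l)
      then have "w \<in> E' l" using E'_mono[of k l] that by auto
      from E'_Suc[OF this] show ?thesis using that Suc by auto
    qed (use that in simp)
    have Max_step: "Max (\<beta> j) < Min (\<beta> (Suc j))" if "1 \<le> j" "j < m" for j
      using \<beta>_chain that unfolding set_before_def by simp
    have \<beta>': "finite (\<beta> j)" "\<beta> j \<noteq> {}" "\<beta> j \<subseteq> Npos" if "1 \<le> j" "j \<le> m" for j
      using \<beta> that unfolding Pf_def by auto
    have Max_le: "Max (\<beta> j) \<le> n" if "1 \<le> j" "j \<le> m" for j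
      using that(2,1)
    proof (induction j rule: inc_induct)
      case base
      then show ?case using \<beta>_n by simp
    next
      case (step j)
      have "Min (\<beta> (Suc j)) \<le> Max (\<beta> (Suc j))" using \<beta>'[of "Suc j"] step by simp
      then show ?case using step Max_step[of j] by simp
    qed
    have run: "(map v [1..<Suc j], 0, 0, P (min m (Suc j))) \<in> E' (if j = 0 then 0 else Max (\<beta> j))"
      if "j \<le> m" for j
      using that
    proof (induction j)
      case 0
      show ?case using P assms(1) unfolding E'_def W0_def by auto
    next
      case (Suc j)
      have "\<beta> (Suc j) \<subseteq> {(if j = 0 then 0 else Max (\<beta> j))<..n}"
      proof
        fix i
        assume i: "i \<in> \<beta> (Suc j)"
        then have "i \<le> Max (\<beta> (Suc j))" "Min (\<beta> (Suc j)) \<le> i" "1 \<le> i"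
          using \<beta>'[of "Suc j"] Suc.prems by auto
        then show "i \<in> {(if j = 0 then 0 else Max (\<beta> j))<..n}"
          using Max_le[of "Suc j"] Max_step[of j] Suc.prems by auto
      qed
      moreover have "min m (Suc j) = Suc j" using Suc.prems by simp
      then have "(map v [1..<Suc j], 0, 0, P (Suc j)) \<in> E' (if j = 0 then 0 else Max (\<beta> j))"
        using Suc.IH[OF Suc_leD[OF Suc.prems]] by (simp only:)
      moreover have "P (min m (Suc (Suc j))) \<in> T" using P assms(1) by simp
      ultimately have "(map v [1..<Suc j] @ [v (Suc j)], 0, 0, P (min m (Suc (Suc j))))
          \<in> E' (Max (\<beta> (Suc j)))"
        unfolding v_def using \<beta>'[of "Suc j"] Suc.prems stp
        by (intro block_run[where E = E' and n = n]) auto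
      moreover have "[1..<Suc (Suc j)] = [1..<Suc j] @ [Suc j]" by simp
      ultimately show ?case by (simp del: upt_Suc)
    qed
    have "Max (\<beta> m) \<in> \<beta> m" using \<beta>'[of m] assms(1) by simp
    then have "1 \<le> Max (\<beta> m)" using \<beta>'(3)[of m] assms(1) by blast
    then have "E' (Max (\<beta> m)) \<subseteq> block_inv p m L T"
      using E_inv G \<beta>_n unfolding E'_def by auto
    then have "(map v [1..<Suc m], 0, 0, P m) \<in> block_inv p m L T"
      using run[of m] assms(1) by auto
    moreover have len: "length (map v [1..<Suc m]) = m" by (simp del: upt_Suc)
    ultimately obtain ys where ys: "map v [1..<Suc m] = map int ys" "L ys"
      unfolding block_inv_def by (auto simp del: upt_Suc)
    have "length ys = m" using len unfolding ys(1) by simp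
    then have "map v [1..<Suc m] \<in> map int ` A" using L(3) ys by blast
    then show "map (\<lambda>j. int (\<Sum>i\<in>\<beta> j. \<alpha> (G i)) +
        poly (P j) (int (\<Sum>i\<in>\<beta> j. \<Sum>t\<in>H (G i). f i t))) [1..<Suc m] \<in> map int ` A"
      unfolding v_def a_def \<sigma>_def .
  qed
qed

end
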